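(* Let $\Omega\subsetneq\mathcal{X}$ be a Kobayashi hyperbolic domain in a complex manifold $\mathcal{X}$, with $\overline\Omega^{\mathrm{End}}$ sequentially compact. Then there exists a continuous surjective map $F:\overline\Omega^{\mathsf{k}}\to\overline\Omega^{\mathrm{End}}$ such that $$F\circ i_{\mathsf{k}}=i_\Omega\quad\text{on }\Omega,$$ where $i_\Omega:\Omega\to\overline\Omega^{\mathrm{End}}$ is the inclusion, if and only if $\mathscr{H}(x)\cap\mathscr{H}(y)=\emptyset$ for all $x\ne y\in\partial\overline\Omega^{\mathrm{End}}$.
   Context: $\mathsf{k}_\Omega$ is the Kobayashi distance of $\Omega$; $\Omega$ is Kobayashi hyperbolic if $\mathsf{k}_\Omega$ is a genuine distance. A domain is a nonempty connected open set; $\overline\Omega$ is the closure of $\Omega$ in $\mathcal{X}$. End compactification: let $(K_j)_{j\ge1}$ be an exhaustion of $\overline\Omega$ by compact sets with $K_j\subset\mathrm{int}(K_{j+1})$. An end is a sequence $(F_j)_{j\ge1}$ where $F_j$ is a connected component of $\overline\Omega\setminus K_j$ and $F_{j+1}\subset F_j$. With $\mathcal{E}$ the set of ends, $\overline\Omega^{\mathrm{End}}=\overline\Omega\sqcup\mathcal{E}$. A neighbourhood basis at $x\in\overline\Omega$ is given by the sets $U\cap\overline\Omega$, $U$ a neighbourhood of $x$ in $\mathcal{X}$; at an end $e=(F_j)$ it is given by $\widehat F_j=F_j\sqcup\{(G_\nu)\in\mathcal{E}: G_\nu=F_\nu,\ \nu=1,\dots,j\}$, $j\ge1$. This is a first-countable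 Hausdorff topology independent of the exhaustion. $\partial\overline\Omega^{\mathrm{End}}=\overline\Omega^{\mathrm{End}}\setminus\Omega$. Metric compactification of $(\Omega,\mathsf{k}_\Omega)$: let $C(\Omega)$ be the real-valued continuous functions on $\Omega$ with the topology of local uniform convergence, $C_*(\Omega)$ its quotient by the constant functions with the quotient topology, and $i_{\mathsf{k}}:\Omega\to C_*(\Omega)$, $i_{\mathsf{k}}(x)=[\mathsf{k}_\Omega(x,\cdot)]$. Then $\overline\Omega^{\mathsf{k}}$ is the closure of $i_{\mathsf{k}}(\Omega)$ in $C_*(\Omega)$. For $x\in\partial\overline\Omega^{\mathrm{End}}$: $\mathscr{H}(x)=\{\xi\in\overline\Omega^{\mathsf{k}}\setminus i_{\mathsf{k}}(\Omega): \exists (x_n)\subset\Omega \text{ with } x_n\to x \text{ in } \overline\Omega^{\mathrm{End}} \text{ and } i_{\mathsf{k}}(x_n)\to\xi\}$. *)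

theory Defs
  imports "HOL-Complex_Analysis.Complex_Analysis"
begin

section \<open>Complex manifolds\<close>

text \<open>
  The underlying space of a complex manifold of dimension \<open>CARD('n)\<close> is a Hausdorff
  second-countable type \<open>'a\<close>; the complex structure is given by a holomorphic atlas, a set of pairs
  of a chart domain and a chart map.
\<close>

text \<open>Only meaningful on open sets: complex (Frechet) differentiability at every point.\<close>

definition holomorphic_vec_on ::
  "(complex ^ 'n \<Rightarrow> complex ^ 'm) \<Rightarrow> (complex ^ 'n) set \<Rightarrow> bool" where
  "holomorphic_vec_on f S \<longleftrightarrow>
     (\<forall>x\<in>S. \<exists>f'. (f has_derivative f') (at x) \<and> (\<forall>c v. f' (c *s v) = c *s f' v))"

definition complex_atlas ::
  "('a::{t2_space, second_countable_topology} set \<times> ('a \<Rightarrow> complex ^ 'n)) set \<Rightarrow> bool" where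
  "complex_atlas A \<longleftrightarrow>
     (\<forall>(U, \<phi>)\<in>A. open U \<and> open (\<phi> ` U) \<and> homeomorphism U (\<phi> ` U) \<phi> (inv_into U \<phi>)) \<and>
     (\<Union>(U, \<phi>)\<in>A. U) = UNIV \<and>
     (\<forall>(U, \<phi>)\<in>A. \<forall>(V, \<psi>)\<in>A. holomorphic_vec_on (\<psi> \<circ> inv_into U \<phi>) (\<phi> ` (U \<inter> V)))"


section \<open>The Kobayashi distance\<close>

definition poincare_dist :: "complex \<Rightarrow> complex \<Rightarrow> real" where
  "poincare_dist a b = artanh (norm ((a - b) / (1 - cnj a * b)))"

definition holomorphic_disc ::
  "('a::topological_space set \<times> ('a \<Rightarrow> complex ^ 'n)) set \<Rightarrow> 'a set \<Rightarrow> (complex \<Rightarrow> 'a) \<Rightarrow> bool" where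
  "holomorphic_disc A \<Omega> f \<longleftrightarrow>
     continuous_on (ball 0 1) f \<and> f ` ball 0 1 \<subseteq> \<Omega> \<and>
     (\<forall>(U, \<phi>)\<in>A. \<forall>i. (\<lambda>z. \<phi> (f z) $ i) holomorphic_on {z \<in> ball 0 1. f z \<in> U})"

text \<open>
  The lengths of all chains of holomorphic discs in \<open>\<Omega>\<close> joining \<open>x\<close> to \<open>y\<close>.
  This set is nonempty if \<open>\<Omega>\<close> is a domain and \<open>x, y \<in> \<Omega>\<close>.
\<close>

definition disc_chain_lengths ::
  "('a::topological_space set \<times> ('a \<Rightarrow> complex ^ 'n)) set \<Rightarrow> 'a set \<Rightarrow> 'a \<Rightarrow> 'a \<Rightarrow> real set" where
  "disc_chain_lengths A \<Omega> x y =
     {\<Sum>j\<le>m. poincare_dist (a j) (b j) | (m::nat) f a b.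
        (\<forall>j\<le>m. holomorphic_disc A \<Omega> (f j) \<and> a j \<in> ball 0 1 \<and> b j \<in> ball 0 1) \<and>
        f 0 (a 0) = x \<and> f m (b m) = y \<and>
        (\<forall>j<m. f j (b j) = f (Suc j) (a (Suc j)))}"

text \<open>The value 0 outside \<open>\<Omega>\<close> is a dummy value, as required by \<^locale>\<open>Metric_space\<close>.\<close>

definition kobayashi ::
  "('a::topological_space set \<times> ('a \<Rightarrow> complex ^ 'n)) set \<Rightarrow> 'a set \<Rightarrow> 'a \<Rightarrow> 'a \<Rightarrow> real" where
  "kobayashi A \<Omega> x y = (if x \<in> \<Omega> \<and> y \<in> \<Omega> then Inf (disc_chain_lengths A \<Omega> x y) else 0)"

definition kobayashi_hyperbolic ::
  "('a::topological_space set \<times> ('a \<Rightarrow> complex ^ 'n)) set \<Rightarrow> 'a set \<Rightarrow> bool" where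
  "kobayashi_hyperbolic A \<Omega> \<longleftrightarrow> Metric_space \<Omega> (kobayashi A \<Omega>)"


section \<open>The end compactification\<close>

text \<open>Below, \<open>S\<close> is the closure of the domain; interiors are relative to \<open>S\<close>.\<close>

definition compact_exhaustion :: "'a::topological_space set \<Rightarrow> (nat \<Rightarrow> 'a set) \<Rightarrow> bool" where
  "compact_exhaustion S K \<longleftrightarrow>
     (\<forall>j. compact (K j) \<and> K j \<subseteq> top_of_set S interior_of K (Suc j)) \<and> (\<Union>j. K j) = S"

definition ends :: "'a::topological_space set \<Rightarrow> (nat \<Rightarrow> 'a set) \<Rightarrow> (nat \<Rightarrow> 'a set) set" where
  "ends S K = {F. \<forall>j. F j \<in> components (S - K j) \<and> F (Suc j) \<subseteq> F j}"

definition end_nbhd ::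
  "'a::topological_space set \<Rightarrow> (nat \<Rightarrow> 'a set) \<Rightarrow> (nat \<Rightarrow> 'a set) \<Rightarrow> nat \<Rightarrow> ('a + (nat \<Rightarrow> 'a set)) set"
where
  "end_nbhd S K F j = Inl ` F j \<union> Inr ` {G \<in> ends S K. \<forall>\<nu>\<le>j. G \<nu> = F \<nu>}"

definition end_open ::
  "'a::topological_space set \<Rightarrow> (nat \<Rightarrow> 'a set) \<Rightarrow> ('a + (nat \<Rightarrow> 'a set)) set \<Rightarrow> bool" where
  "end_open S K W \<longleftrightarrow>
     W \<subseteq> Inl ` S \<union> Inr ` ends S K \<and>
     (\<forall>x. Inl x \<in> W \<longrightarrow> (\<exists>U. open U \<and> x \<in> U \<and> Inl ` (U \<inter> S) \<subseteq> W)) \<and>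
     (\<forall>F. Inr F \<in> W \<longrightarrow> (\<exists>j. end_nbhd S K F j \<subseteq> W))"

text \<open>
  A set is open if it contains a basic neighbourhood of each of its points. The basic neighbourhoods
  \<open>end_nbhd S K F j\<close> are indeed neighbourhoods, though not necessarily open, whenever
  the resulting space is sequentially compact.
\<close>

definition end_compactification ::
  "'a::topological_space set \<Rightarrow> (nat \<Rightarrow> 'a set) \<Rightarrow> ('a + (nat \<Rightarrow> 'a set)) topology" where
  "end_compactification S K = topology (end_open S K)"

definition end_boundary ::
  "'a::topological_space set \<Rightarrow> (nat \<Rightarrow> 'a set) \<Rightarrow> ('a + (nat \<Rightarrow> 'a set)) set" where
  "end_boundary \<Omega> K = topspace (end_compactification (closure \<Omega>) K) - Inl ` \<Omega>"

definition seq_compact_space :: "'b topology \<Rightarrow> bool" where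
  "seq_compact_space X \<longleftrightarrow>
     (\<forall>\<sigma>::nat \<Rightarrow> 'b. range \<sigma> \<subseteq> topspace X \<longrightarrow>
        (\<exists>l r. strict_mono (r::nat \<Rightarrow> nat) \<and> limitin X (\<sigma> \<circ> r) l sequentially))"

lemma end_nbhd_mono:
  assumes "F \<in> ends S K" "i \<le> j"
  shows "end_nbhd S K F j \<subseteq> end_nbhd S K F i"
proof -
  have "F (Suc k) \<subseteq> F k" for k
    using assms(1) unfolding ends_def by simp
  then have "F j \<subseteq> F i"
    using assms(2) by (rule lift_Suc_antimono_le)
  then show ?thesis
    using assms(2) unfolding end_nbhd_def by (intro Un_mono image_mono) auto
qed

lemma istopology_end_open: "istopology (end_open S K)"
  unfolding istopology_def
proof (intro conjI allI impI)
  fix V W assume V: "end_open S K V" and W: "end_open S K W"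
  show "end_open S K (V \<inter> W)"
    unfolding end_open_def
  proof (intro conjI allI impI)
    show "V \<inter> W \<subseteq> Inl ` S \<union> Inr ` ends S K"
      using V by (auto simp: end_open_def)
  next
    fix x assume "Inl x \<in> V \<inter> W"
    then have x: "Inl x \<in> V" "Inl x \<in> W" by simp_all
    obtain U1 where U1: "open U1" "x \<in> U1" "Inl ` (U1 \<inter> S) \<subseteq> V"
      using V x(1) unfolding end_open_def by meson
    obtain U2 where U2: "open U2" "x \<in> U2" "Inl ` (U2 \<inter> S) \<subseteq> W"
      using W x(2) unfolding end_open_def by meson
    show "\<exists>U. open U \<and> x \<in> U \<and> Inl ` (U \<inter> S) \<subseteq> V \<inter> W"
      using U1 U2 by (intro exI[of _ "U1 \<inter> U2"]) auto
  next
    fix F assume F: "Inr F \<in> V \<inter> W"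
    then have F': "Inr F \<in> V" "Inr F \<in> W" by simp_all
    obtain i where i: "end_nbhd S K F i \<subseteq> V"
      using V F'(1) unfolding end_open_def by meson
    obtain j where j: "end_nbhd S K F j \<subseteq> W"
      using W F'(2) unfolding end_open_def by meson
    have "F \<in> ends S K"
      using F V by (auto simp: end_open_def)
    then show "\<exists>k. end_nbhd S K F k \<subseteq> V \<inter> W"
      using i j end_nbhd_mono[of F S K i "max i j"] end_nbhd_mono[of F S K j "max i j"]
      by (intro exI[of _ "max i j"]) auto
  qed
next
  fix \<W> assume *: "\<forall>W\<in>\<W>. end_open S K W"
  show "end_open S K (\<Union>\<W>)"
    unfolding end_open_def
  proof (intro conjI allI impI)
    show "\<Union>\<W> \<subseteq> Inl ` S \<union> Inr ` ends S K"
      using * by (auto simp: end_open_def)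
  next
    fix x assume "Inl x \<in> \<Union>\<W>"
    then obtain W where W: "W \<in> \<W>" "Inl x \<in> W" by (rule UnionE)
    have "end_open S K W" using * W(1) by (rule bspec)
    then obtain U where "open U" "x \<in> U" "Inl ` (U \<inter> S) \<subseteq> W"
      using W(2) unfolding end_open_def by meson
    with W(1) show "\<exists>U. open U \<and> x \<in> U \<and> Inl ` (U \<inter> S) \<subseteq> \<Union>\<W>"
      by (intro exI[of _ U]) auto
  next
    fix F assume "Inr F \<in> \<Union>\<W>"
    then obtain W where W: "W \<in> \<W>" "Inr F \<in> W" by (rule UnionE)
    have "end_open S K W" using * W(1) by (rule bspec)
    then obtain j where "end_nbhd S K F j \<subseteq> W"
      using W(2) unfolding end_open_def by meson
    with W(1) show "\<exists>j. end_nbhd S K F j \<subseteq> \<Union>\<W>"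
      by (intro exI[of _ j]) auto
  qed
qed

lemma openin_end_compactification: "openin (end_compactification S K) = end_open S K"
  unfolding end_compactification_def by (rule topology_inverse'[OF istopology_end_open])

lemma topspace_end_compactification:
  "topspace (end_compactification S K) = Inl ` S \<union> Inr ` ends S K"
proof
  show "topspace (end_compactification S K) \<subseteq> Inl ` S \<union> Inr ` ends S K"
    using openin_topspace[of "end_compactification S K"]
    unfolding openin_end_compactification end_open_def by (rule conjunct1)
next
  have "F 0 \<subseteq> S" if "F \<in> ends S K" for F
  proof -
    have "F 0 \<in> components (S - K 0)"
      using that unfolding ends_def by simp
    then show ?thesis
      using in_components_subset by blast
  qed
  then have *: "end_nbhd S K F 0 \<subseteq> Inl ` S \<union> Inr ` ends S K" if "F \<in> ends S K" for F
    using that unfolding end_nbhd_def by blast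
  have "end_open S K (Inl ` S \<union> Inr ` ends S K)"
    unfolding end_open_def
  proof (intro conjI allI impI)
    fix x :: 'a
    show "\<exists>U. open U \<and> x \<in> U \<and> Inl ` (U \<inter> S) \<subseteq> Inl ` S \<union> Inr ` ends S K"
      by (rule exI[of _ UNIV]) auto
  next
    fix F :: "nat \<Rightarrow> 'a set" assume "Inr F \<in> Inl ` S \<union> Inr ` ends S K"
    then have "F \<in> ends S K" by auto
    then show "\<exists>j. end_nbhd S K F j \<subseteq> Inl ` S \<union> Inr ` ends S K"
      using * by blast
  qed simp
  then show "Inl ` S \<union> Inr ` ends S K \<subseteq> topspace (end_compactification S K)"
    by (intro openin_subset) (simp only: openin_end_compactification)
qed


section \<open>The metric compactification\<close>

text \<open>Functions on \<open>\<Omega>\<close> are represented by extensional functions.\<close>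

definition cont_funs :: "'a::topological_space set \<Rightarrow> ('a \<Rightarrow> real) set" where
  "cont_funs \<Omega> = {f \<in> extensional \<Omega>. continuous_on \<Omega> f}"

text \<open>
  Local uniform convergence on \<open>\<Omega>\<close>, which is locally compact in our setting, is
  uniform convergence on compact subsets.
\<close>

definition cont_funs_open :: "'a::topological_space set \<Rightarrow> ('a \<Rightarrow> real) set \<Rightarrow> bool" where
  "cont_funs_open \<Omega> W \<longleftrightarrow>
     W \<subseteq> cont_funs \<Omega> \<and>
     (\<forall>f\<in>W. \<exists>K \<epsilon>. compact K \<and> K \<subseteq> \<Omega> \<and> \<epsilon> > 0 \<and>
        {g \<in> cont_funs \<Omega>. \<forall>x\<in>K. \<bar>g x - f x\<bar> < \<epsilon>} \<subseteq> W)"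

definition cont_funs_top :: "'a::topological_space set \<Rightarrow> ('a \<Rightarrow> real) topology" where
  "cont_funs_top \<Omega> = topology (cont_funs_open \<Omega>)"

definition mod_const_rel ::
  "'a::topological_space set \<Rightarrow> (('a \<Rightarrow> real) \<times> ('a \<Rightarrow> real)) set" where
  "mod_const_rel \<Omega> =
     {(f, g). f \<in> cont_funs \<Omega> \<and> g \<in> cont_funs \<Omega> \<and> (\<exists>c. \<forall>x\<in>\<Omega>. g x = f x + c)}"

text \<open>The union \<open>\<Union>\<U>\<close> is the preimage of \<open>\<U>\<close> under the quotient map.\<close>

definition cont_funs_mod_const_top :: "'a::topological_space set \<Rightarrow> ('a \<Rightarrow> real) set topology" where
  "cont_funs_mod_const_top \<Omega> =
     topology (\<lambda>\<U>. \<U> \<subseteq> cont_funs \<Omega> // mod_const_rel \<Omega> \<and> openin (cont_funs_top \<Omega>) (\<Union>\<U>))"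

definition metric_embed ::
  "'a::topological_space set \<Rightarrow> ('a \<Rightarrow> 'a \<Rightarrow> real) \<Rightarrow> 'a \<Rightarrow> ('a \<Rightarrow> real) set" where
  "metric_embed \<Omega> d x = mod_const_rel \<Omega> `` {restrict (d x) \<Omega>}"

definition metric_compactification ::
  "'a::topological_space set \<Rightarrow> ('a \<Rightarrow> 'a \<Rightarrow> real) \<Rightarrow> ('a \<Rightarrow> real) set topology" where
  "metric_compactification \<Omega> d =
     subtopology (cont_funs_mod_const_top \<Omega>)
       (cont_funs_mod_const_top \<Omega> closure_of (metric_embed \<Omega> d ` \<Omega>))"

lemma istopology_cont_funs_open: "istopology (cont_funs_open \<Omega>)"
  unfolding istopology_def
proof (intro conjI allI impI)
  fix V W assume V: "cont_funs_open \<Omega> V" and W: "cont_funs_open \<Omega> W"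
  show "cont_funs_open \<Omega> (V \<inter> W)"
    unfolding cont_funs_open_def
  proof (intro conjI ballI)
    show "V \<inter> W \<subseteq> cont_funs \<Omega>"
      using V by (auto simp: cont_funs_open_def)
  next
    fix f assume f: "f \<in> V \<inter> W"
    obtain K \<epsilon> where 1: "compact K" "K \<subseteq> \<Omega>" "\<epsilon> > 0"
      "{g \<in> cont_funs \<Omega>. \<forall>x\<in>K. \<bar>g x - f x\<bar> < \<epsilon>} \<subseteq> V"
      using V f unfolding cont_funs_open_def by (meson IntD1)
    obtain L \<delta> where 2: "compact L" "L \<subseteq> \<Omega>" "\<delta> > 0"
      "{g \<in> cont_funs \<Omega>. \<forall>x\<in>L. \<bar>g x - f x\<bar> < \<delta>} \<subseteq> W"
      using W f unfolding cont_funs_open_def by (meson IntD2)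
    show "\<exists>K \<epsilon>. compact K \<and> K \<subseteq> \<Omega> \<and> \<epsilon> > 0 \<and>
        {g \<in> cont_funs \<Omega>. \<forall>x\<in>K. \<bar>g x - f x\<bar> < \<epsilon>} \<subseteq> V \<inter> W"
      using 1 2 by (intro exI[of _ "K \<union> L"] exI[of _ "min \<epsilon> \<delta>"]) auto
  qed
next
  fix \<W> assume *: "\<forall>W\<in>\<W>. cont_funs_open \<Omega> W"
  show "cont_funs_open \<Omega> (\<Union>\<W>)"
    unfolding cont_funs_open_def
  proof (intro conjI ballI)
    show "\<Union>\<W> \<subseteq> cont_funs \<Omega>"
      using * by (auto simp: cont_funs_open_def)
  next
    fix f assume "f \<in> \<Union>\<W>"
    then obtain W where W: "W \<in> \<W>" "f \<in> W" by blast
    then obtain K \<epsilon> where "compact K" "K \<subseteq> \<Omega>" "\<epsilon> > 0"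
      "{g \<in> cont_funs \<Omega>. \<forall>x\<in>K. \<bar>g x - f x\<bar> < \<epsilon>} \<subseteq> W"
      using * unfolding cont_funs_open_def by meson
    with W show "\<exists>K \<epsilon>. compact K \<and> K \<subseteq> \<Omega> \<and> \<epsilon> > 0 \<and>
        {g \<in> cont_funs \<Omega>. \<forall>x\<in>K. \<bar>g x - f x\<bar> < \<epsilon>} \<subseteq> \<Union>\<W>"
      by (intro exI[of _ K] exI[of _ \<epsilon>]) auto
  qed
qed

lemma openin_cont_funs_top: "openin (cont_funs_top \<Omega>) = cont_funs_open \<Omega>"
  unfolding cont_funs_top_def by (rule topology_inverse'[OF istopology_cont_funs_open])

lemma equiv_mod_const_rel: "equiv (cont_funs \<Omega>) (mod_const_rel \<Omega>)"
proof (rule equivI)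
  show "mod_const_rel \<Omega> \<subseteq> cont_funs \<Omega> \<times> cont_funs \<Omega>"
    by (auto simp: mod_const_rel_def)
  show "refl_on (cont_funs \<Omega>) (mod_const_rel \<Omega>)"
    by (auto simp: refl_on_def mod_const_rel_def intro: exI[of _ 0])
  show "sym (mod_const_rel \<Omega>)"
  proof (rule symI)
    fix f g assume "(f, g) \<in> mod_const_rel \<Omega>"
    then obtain c where "f \<in> cont_funs \<Omega>" "g \<in> cont_funs \<Omega>" "\<forall>x\<in>\<Omega>. g x = f x + c"
      by (auto simp: mod_const_rel_def)
    then show "(g, f) \<in> mod_const_rel \<Omega>"
      by (auto simp: mod_const_rel_def intro: exI[of _ "-c"])
  qed
  show "trans (mod_const_rel \<Omega>)"
  proof (rule transI)
    fix f g h assume "(f, g) \<in> mod_const_rel \<Omega>" "(g, h) \<in> mod_const_rel \<Omega>"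
    then obtain c d where fh: "f \<in> cont_funs \<Omega>" "h \<in> cont_funs \<Omega>"
      and c: "\<forall>x\<in>\<Omega>. g x = f x + c" and d: "\<forall>x\<in>\<Omega>. h x = g x + d"
      unfolding mod_const_rel_def by blast
    have "\<forall>x\<in>\<Omega>. h x = f x + (c + d)"
      using c d by simp
    with fh show "(f, h) \<in> mod_const_rel \<Omega>"
      unfolding mod_const_rel_def by blast
  qed
qed

lemma openin_cont_funs_mod_const_top:
  "openin (cont_funs_mod_const_top \<Omega>) \<U> \<longleftrightarrow>
     \<U> \<subseteq> cont_funs \<Omega> // mod_const_rel \<Omega> \<and> openin (cont_funs_top \<Omega>) (\<Union>\<U>)"
proof -
  let ?P = "\<lambda>\<U>. \<U> \<subseteq> cont_funs \<Omega> // mod_const_rel \<Omega> \<and> openin (cont_funs_top \<Omega>) (\<Union>\<U>)"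
  have "istopology ?P"
    unfolding istopology_def
  proof (rule conjI; intro allI impI)
    fix \<U> \<V> assume U: "?P \<U>" and V: "?P \<V>"
    have "\<Union>(\<U> \<inter> \<V>) = \<Union>\<U> \<inter> \<Union>\<V>"
    proof
      show "\<Union>\<U> \<inter> \<Union>\<V> \<subseteq> \<Union>(\<U> \<inter> \<V>)"
      proof
        fix f assume "f \<in> \<Union>\<U> \<inter> \<Union>\<V>"
        then obtain A B where AB: "A \<in> \<U>" "B \<in> \<V>" "f \<in> A" "f \<in> B" by blast
        then have "A = B"
          using U V quotient_disj[OF equiv_mod_const_rel[of \<Omega>], of A B] by blast
        with AB show "f \<in> \<Union>(\<U> \<inter> \<V>)" by blast
      qed
    qed blast
    with U V show "?P (\<U> \<inter> \<V>)"
      by (auto simp del: Union_Int_subset)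
  next
    fix \<W> assume *: "\<forall>\<U>\<in>\<W>. ?P \<U>"
    have "\<Union>(\<Union>\<W>) = (\<Union>\<U>\<in>\<W>. \<Union>\<U>)" by blast
    moreover have "openin (cont_funs_top \<Omega>) (\<Union>\<U>\<in>\<W>. \<Union>\<U>)"
      using * by (intro openin_Union) blast
    ultimately show "?P (\<Union>\<W>)" using * by (simp add: Sup_le_iff)
  qed
  then show ?thesis
    unfolding cont_funs_mod_const_top_def by (simp add: topology_inverse')
qed


section \<open>Fibres over boundary points\<close>

text \<open>The set \<open>\<H>(x)\<close>, for a point \<open>x\<close> of \<open>end_boundary \<Omega> K\<close>.\<close>

definition metric_fibre ::
  "'a::topological_space set \<Rightarrow> (nat \<Rightarrow> 'a set) \<Rightarrow> ('a \<Rightarrow> 'a \<Rightarrow> real) \<Rightarrow>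
     'a + (nat \<Rightarrow> 'a set) \<Rightarrow> ('a \<Rightarrow> real) set set" where
  "metric_fibre \<Omega> K d x =
     {\<xi> \<in> topspace (metric_compactification \<Omega> d) - metric_embed \<Omega> d ` \<Omega>.
        \<exists>s::nat \<Rightarrow> 'a. range s \<subseteq> \<Omega> \<and>
          limitin (end_compactification (closure \<Omega>) K) (\<lambda>n. Inl (s n)) x sequentially \<and>
          limitin (metric_compactification \<Omega> d) (\<lambda>n. metric_embed \<Omega> d (s n)) \<xi> sequentially}"

end

theory Submission
  imports Defs
begin

text \<open>
  The difficulty lies in the points of the metric compactification that come from \<open>\<Omega>\<close> itself. The
  Kobayashi distance need not be proper, so a sequence could escape from \<open>\<Omega>\<close> and yet have its
  distance functions converge, modulo constants, to the distance function of an interior point. What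
  excludes this is that the Kobayashi distance is a length distance: a chain of discs that realises
  \<open>k(x, y)\<close> up to \<open>\<epsilon>\<close> can be followed along Poincare geodesics, so if \<open>x\<close> lies in a set \<open>C\<close> and \<open>y\<close>
  does not, the chain meets the frontier of \<open>C\<close> in a point \<open>z\<close> with \<open>k(x, z) + k(z, y) < k(x, y) + \<epsilon>\<close>
  (lemma \<open>kobayashi_crosses_frontier\<close>). Suppose that the classes of \<open>k(x\<^sub>n, \<cdot>)\<close> converge to the class
  of \<open>k(x, \<cdot>)\<close>, let \<open>C\<close> be a compact neighbourhood of \<open>x\<close>, and let \<open>r > 0\<close> be the distance from
  \<open>x\<close> to its frontier. Were \<open>x\<^sub>n\<close> outside \<open>C\<close>, there would be a frontier point \<open>z\<close> at which
  \<open>k(x\<^sub>n, z) - k(x\<^sub>n, x)\<close> is at most about \<open>- r\<close>, while uniform convergence on the frontier makes it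
  about \<open>k(x, z) \<ge> r\<close>. Hence \<open>x\<^sub>n\<close> tends to \<open>x\<close>, and the embedding of \<open>\<Omega>\<close> is a homeomorphism onto
  its image (lemmas \<open>embed_continuous\<close> and \<open>embed_converges_imp_tendsto\<close>).

  Call \<open>l\<close> related to \<open>\<xi>\<close> if some sequence of \<open>\<Omega>\<close> converges to \<open>\<xi>\<close> in the metric compactification
  and to \<open>l\<close> in the end compactification. By the above an interior point is related to itself only,
  and any other \<open>\<xi>\<close> is related to exactly those \<open>l\<close> for which it lies in the fibre over \<open>l\<close>. Thus the
  fibres are disjoint if and only if the relation is single valued. If a continuous \<open>F\<close> extends the
  inclusion, then \<open>l = F \<xi>\<close>, so it is. Conversely a single valued relation is the graph of a continuous
  extension (lemma \<open>continuous_extension_of_dense\<close>), because the metric compactification is first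
  countable and the end compactification is Hausdorff and sequentially compact. The extension is onto:
  every point of the end compactification is the limit of a sequence of \<open>\<Omega>\<close>, and the distance functions
  of that sequence, being 1-Lipschitz, converge along a subsequence.

  The closure of \<open>\<Omega>\<close> need not be locally connected, so the components that define an end need not be
  open, and the Hausdorff property has to come from sequential compactness. The latter allows only
  finitely many components of the complement of a given compact set to carry ends, and these
  components cover the complement of a larger compact set; there they are open.
\<close>

section \<open>The Poincare distance\<close>

lemma poincare_dist_eq_Moebius:
  "poincare_dist a b = artanh (norm (Moebius_function 0 a b))"
  by (simp add: poincare_dist_def Moebius_function_simple norm_divide norm_minus_commute)

lemma poincare_dist_nonneg:
  assumes "a \<in> ball 0 1" "b \<in> ball 0 1"
  shows "poincare_dist a b \<ge> 0"
proof -
  have "norm (Moebius_function 0 a b) < 1"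
    using assms by (intro Moebius_function_norm_lt_1) auto
  then show ?thesis
    unfolding poincare_dist_eq_Moebius artanh_def by (simp add: field_simps)
qed

lemma one_plus_cnj_mult_nonzero:
  assumes "norm a < 1" "norm u < 1"
  shows "1 + cnj a * u \<noteq> 0"
proof
  assume "1 + cnj a * u = 0"
  then have "norm (cnj a * u) = 1"
    by (metis add_eq_0_iff norm_minus_cancel norm_one)
  moreover have "norm a * norm u < 1"
    using assms by (metis norm_ge_zero norm_mult norm_mult_less mult.right_neutral)
  ultimately show False by (simp add: norm_mult)
qed

lemma poincare_dist_Moebius:
  assumes a: "norm a < 1" and u: "norm u < 1" and v: "norm v < 1"
  shows "poincare_dist (Moebius_function 0 (-a) u) (Moebius_function 0 (-a) v) = poincare_dist u v"
proof -
  define p q where "p = 1 + cnj a * u" and "q = 1 + cnj a * v"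
  have nz: "p \<noteq> 0" "q \<noteq> 0"
    unfolding p_def q_def using one_plus_cnj_mult_nonzero assms by blast+
  have np: "norm (cnj p) = norm p" by simp
  have cp: "cnj p \<noteq> 0" using nz by simp
  have cpe: "cnj p = 1 + a * cnj u" by (simp add: p_def)
  have r: "1 - a * cnj a \<noteq> 0"
    using one_plus_cnj_mult_nonzero[of a "-a"] a by (simp add: mult.commute)
  have 1: "(u + a) / p - (v + a) / q = (u - v) * (1 - a * cnj a) / (p * q)"
    using nz by (simp add: divide_simps) (simp add: p_def q_def algebra_simps)
  have 2: "1 - cnj ((u + a) / p) * ((v + a) / q) = (1 - a * cnj a) * (1 - cnj u * v) / (cnj p * q)"
    using nz cp by (simp add: divide_simps) (simp add: cpe q_def algebra_simps)
  have "norm (((u + a) / p - (v + a) / q) / (1 - cnj ((u + a) / p) * ((v + a) / q)))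
      = norm ((u - v) / (1 - cnj u * v))"
    unfolding 1 2 using nz r by (simp add: norm_mult norm_divide del: complex_cnj_mult complex_cnj_add)
  then show ?thesis
    by (simp add: poincare_dist_def Moebius_function_simple p_def q_def)
qed

text \<open>
  Radial segments are geodesics: this is the addition formula for \<open>artanh\<close>, since the pseudohyperbolic
  distance of \<open>t w\<close> and \<open>w\<close> is \<open>(1 - t) r / (1 - t r\<^sup>2)\<close> for \<open>r = norm w\<close>.
\<close>

lemma poincare_dist_radial:
  assumes w: "norm w < 1" and t: "t \<in> {0..1}"
  shows "poincare_dist 0 (of_real t * w) + poincare_dist (of_real t * w) w = poincare_dist 0 w"
proof -
  define r where "r = norm w"
  have r: "0 \<le> r" "r < 1" using w by (auto simp: r_def)
  have tr: "t * r < 1" "0 \<le> t * r" "t * r * r < 1" 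
  proof -
    show *: "t * r < 1" "0 \<le> t * r" using t r mult_left_le_one_le[of r t] by auto
    then show "t * r * r < 1" using r mult_left_le_one_le[of r "t * r"] by (auto simp: mult_ac)
  qed
  have "of_real t * w - w = - (of_real (1 - t) * w)" by (simp add: algebra_simps)
  then have n1: "norm (of_real t * w - w) = (1 - t) * r"
    using t by (simp only: norm_minus_cancel norm_mult norm_of_real r_def) simp
  have "cnj (of_real t * w) * w = of_real (t * r * r)"
    using complex_norm_square[of w] by (simp add: r_def power2_eq_square mult_ac)
  then have "1 - cnj (of_real t * w) * w = of_real (1 - t * r * r)" by simp
  then have n2: "norm (1 - cnj (of_real t * w) * w) = 1 - t * r * r"
    using tr by (simp only: norm_of_real)
  have A: "poincare_dist (of_real t * w) w = artanh ((1 - t) * r / (1 - t * r * r))"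
    unfolding poincare_dist_def norm_divide n1 n2 ..
  have B: "poincare_dist 0 (of_real t * w) = artanh (t * r)" "poincare_dist 0 w = artanh r"
    using t by (auto simp: poincare_dist_def r_def norm_mult)
  have e1: "1 + (1 - t) * r / (1 - t * r * r) = (1 + r) * (1 - t * r) / (1 - t * r * r)"
    using tr by (simp add: field_simps)
  have e2: "1 - (1 - t) * r / (1 - t * r * r) = (1 - r) * (1 + t * r) / (1 - t * r * r)"
    using tr by (simp add: field_simps)
  have e3: "(1 + (1 - t) * r / (1 - t * r * r)) / (1 - (1 - t) * r / (1 - t * r * r))
     = ((1 + r) / (1 - r)) / ((1 + t * r) / (1 - t * r))"
    unfolding e1 e2 using tr r by (simp add: divide_simps)
  have "ln (((1 + r) / (1 - r)) / ((1 + t * r) / (1 - t * r))) = ln ((1 + r) / (1 - r)) - ln ((1 + t * r) / (1 - t * r))"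
    using tr r by (intro ln_divide_pos) auto
  then show ?thesis
    unfolding A B artanh_def e3 by (simp only: diff_divide_distrib)
qed

text \<open>
  The automorphism of the disc that takes \<open>0\<close> to \<open>a\<close> carries a radial segment to the geodesic.
\<close>

lemma poincare_geodesic:
  assumes a: "a \<in> ball 0 1" and b: "b \<in> ball 0 1"
  obtains \<gamma> :: "real \<Rightarrow> complex" where "continuous_on {0..1} \<gamma>" "\<gamma> 0 = a" "\<gamma> 1 = b"
    "\<forall>t\<in>{0..1}. \<gamma> t \<in> ball 0 1 \<and> poincare_dist a (\<gamma> t) + poincare_dist (\<gamma> t) b = poincare_dist a b"
proof -
  define w where "w = Moebius_function 0 a b"
  have na: "norm a < 1" "norm (-a) < 1" and nb: "norm b < 1" using a b by auto
  have w: "norm w < 1"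
    unfolding w_def using na nb by (intro Moebius_function_norm_lt_1)
  have tw: "norm (of_real t * w) < 1" if "t \<in> {0..1}" for t
    using w that mult_left_le_one_le[of "norm w" t] by (auto simp: norm_mult)
  define \<gamma> where "\<gamma> = (\<lambda>t::real. Moebius_function 0 (-a) (of_real t * w))"
  have 0: "\<gamma> 0 = a" by (simp add: \<gamma>_def Moebius_function_simple)
  have 1: "\<gamma> 1 = b"
    using Moebius_function_compose[of "-a" a b] na nb by (simp add: \<gamma>_def w_def)
  have "continuous_on {0..1} \<gamma>"
    unfolding \<gamma>_def
  proof (rule continuous_on_compose2[of "ball 0 1" "Moebius_function 0 (-a)"])
    show "continuous_on (ball 0 1) (Moebius_function 0 (-a))"
      using Moebius_function_holomorphic[OF na(2)] by (rule holomorphic_on_imp_continuous_on)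
  qed (use tw in \<open>auto intro!: continuous_intros\<close>)
  moreover have "\<gamma> t \<in> ball 0 1 \<and> poincare_dist a (\<gamma> t) + poincare_dist (\<gamma> t) b = poincare_dist a b"
    if t: "t \<in> {0..1}" for t
  proof
    show "\<gamma> t \<in> ball 0 1"
      using Moebius_function_norm_lt_1[OF na(2) tw[OF t]] by (simp add: \<gamma>_def)
    have "poincare_dist a (\<gamma> t) = poincare_dist 0 (of_real t * w)"
      using poincare_dist_Moebius[OF na(1), of 0 "of_real t * w"] tw[OF t] 0 by (simp add: \<gamma>_def)
    moreover have "poincare_dist (\<gamma> t) b = poincare_dist (of_real t * w) w"
      using poincare_dist_Moebius[OF na(1) tw[OF t] w] 1 by (simp add: \<gamma>_def)
    moreover have "poincare_dist a b = poincare_dist 0 w"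
      using poincare_dist_Moebius[OF na(1), of 0 w] w 0 1 by (simp add: \<gamma>_def)
    ultimately show "poincare_dist a (\<gamma> t) + poincare_dist (\<gamma> t) b = poincare_dist a b"
      using poincare_dist_radial[OF w t] by simp
  qed
  ultimately show ?thesis using that 0 1 by blast
qed

section \<open>The Kobayashi distance along chains of discs\<close>

text \<open>
  The inductive form of the chains in \<^const>\<open>disc_chain_lengths\<close>, for proofs that follow a chain disc
  by disc.
\<close>

inductive disc_chain for A \<Omega> where
  disc_chain_disc: "\<lbrakk>holomorphic_disc A \<Omega> f; a \<in> ball 0 1; b \<in> ball 0 1\<rbrakk>
     \<Longrightarrow> disc_chain A \<Omega> (f a) (f b) (poincare_dist a b)"
| disc_chain_snoc: "\<lbrakk>disc_chain A \<Omega> x (f a) l; holomorphic_disc A \<Omega> f; a \<in> ball 0 1; b \<in> ball 0 1\<rbrakk>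
     \<Longrightarrow> disc_chain A \<Omega> x (f b) (l + poincare_dist a b)"

lemma disc_chain_lengths_eq: "disc_chain_lengths A \<Omega> x y = {l. disc_chain A \<Omega> x y l}"
proof -
  have "disc_chain A \<Omega> x y (\<Sum>j\<le>m. poincare_dist (a j) (b j))"
    if "\<forall>j\<le>m. holomorphic_disc A \<Omega> (f j) \<and> a j \<in> ball 0 1 \<and> b j \<in> ball 0 1"
      "f 0 (a 0) = x" "f m (b m) = y" "\<forall>j<m. f j (b j) = f (Suc j) (a (Suc j))" for m :: nat and f a b
    using that
  proof (induction m arbitrary: y)
    case 0
    then show ?case using disc_chain_disc[of A \<Omega> "f 0" "a 0" "b 0"] by simp
  next
    case (Suc m)
    have "disc_chain A \<Omega> x (f m (b m)) (\<Sum>j\<le>m. poincare_dist (a j) (b j))"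
      using Suc by (intro Suc.IH) auto
    then have "disc_chain A \<Omega> x (f (Suc m) (a (Suc m))) (\<Sum>j\<le>m. poincare_dist (a j) (b j))"
      using Suc.prems by simp
    then show ?case
      using disc_chain_snoc[of A \<Omega> x "f (Suc m)" "a (Suc m)" _ "b (Suc m)"] Suc.prems by simp
  qed
  moreover have "\<exists>(m::nat) f a b. l = (\<Sum>j\<le>m. poincare_dist (a j) (b j)) \<and>
        (\<forall>j\<le>m. holomorphic_disc A \<Omega> (f j) \<and> a j \<in> ball 0 1 \<and> b j \<in> ball 0 1) \<and>
        f 0 (a 0) = x \<and> f m (b m) = y \<and>
        (\<forall>j<m. f j (b j) = f (Suc j) (a (Suc j)))" if "disc_chain A \<Omega> x y l" for l
    using that
  proof (induction rule: disc_chain.induct)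
    case (disc_chain_disc f a b)
    then show ?case
      by (intro exI[of _ 0] exI[of _ "\<lambda>_. f"] exI[of _ "\<lambda>_. a"] exI[of _ "\<lambda>_. b"]) auto
  next
    case (disc_chain_snoc x f a l b)
    then obtain m :: nat and g c d where *: "l = (\<Sum>j\<le>m. poincare_dist (c j) (d j))"
        "\<forall>j\<le>m. holomorphic_disc A \<Omega> (g j) \<and> c j \<in> ball 0 1 \<and> d j \<in> ball 0 1"
        "g 0 (c 0) = x" "g m (d m) = f a"
        "\<forall>j<m. g j (d j) = g (Suc j) (c (Suc j))" by blast
    show ?case
      by (rule exI[of _ "Suc m"], rule exI[of _ "g(Suc m := f)"], rule exI[of _ "c(Suc m := a)"],
            rule exI[of _ "d(Suc m := b)"])
        (use * disc_chain_snoc.hyps in \<open>auto simp: less_Suc_eq_le le_Suc_eq\<close>)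
  qed
  ultimately show ?thesis
    unfolding disc_chain_lengths_def by blast
qed

lemma disc_chain_nonneg: "disc_chain A \<Omega> x y l \<Longrightarrow> l \<ge> 0"
  by (induction rule: disc_chain.induct) (auto intro!: add_nonneg_nonneg poincare_dist_nonneg)

lemma holomorphic_disc_in: "holomorphic_disc A \<Omega> f \<Longrightarrow> a \<in> ball 0 1 \<Longrightarrow> f a \<in> \<Omega>"
  unfolding holomorphic_disc_def by blast

lemma kobayashi_le_chain:
  assumes "disc_chain A \<Omega> x y l"
  shows "kobayashi A \<Omega> x y \<le> l"
proof -
  have "Inf {l. disc_chain A \<Omega> x y l} \<le> l"
    using assms disc_chain_nonneg[of A \<Omega> x y] by (intro cInf_lower bdd_belowI[of _ 0]) auto
  then show ?thesis
    using disc_chain_nonneg[OF assms] by (simp add: kobayashi_def disc_chain_lengths_eq)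
qed

lemma kobayashi_le_poincare:
  assumes "holomorphic_disc A \<Omega> f" "a \<in> ball 0 1" "b \<in> ball 0 1"
  shows "kobayashi A \<Omega> (f a) (f b) \<le> poincare_dist a b"
  using assms by (intro kobayashi_le_chain disc_chain_disc)

lemma disc_crosses_frontier:
  assumes f: "holomorphic_disc A \<Omega> f" and a: "a \<in> ball 0 1" and b: "b \<in> ball 0 1"
    and C: "f a \<in> C" "f b \<notin> C"
  shows "\<exists>c\<in>ball 0 1. f c \<in> frontier C \<and> poincare_dist a c + poincare_dist c b = poincare_dist a b"
proof -
  obtain \<gamma> where \<gamma>: "continuous_on {0..1::real} \<gamma>" "\<gamma> 0 = a" "\<gamma> 1 = b"
    "\<forall>t\<in>{0..1}. \<gamma> t \<in> ball 0 1 \<and> poincare_dist a (\<gamma> t) + poincare_dist (\<gamma> t) b = poincare_dist a b"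
    by (rule poincare_geodesic[OF a b])
  have "continuous_on {0..1} (\<lambda>t. f (\<gamma> t))"
  proof (rule continuous_on_compose2[OF _ \<gamma>(1)])
    show "continuous_on (ball 0 1) f" using f by (simp add: holomorphic_disc_def)
    show "\<gamma> ` {0..1} \<subseteq> ball 0 1" using \<gamma>(4) by blast
  qed
  then have "connected ((\<lambda>t. f (\<gamma> t)) ` {0..1})"
    by (intro connected_continuous_image) auto
  moreover have "f a \<in> (\<lambda>t. f (\<gamma> t)) ` {0..1}" "f b \<in> (\<lambda>t. f (\<gamma> t)) ` {0..1}"
    using \<gamma>(2,3) by force+
  ultimately have "(\<lambda>t. f (\<gamma> t)) ` {0..1} \<inter> frontier C \<noteq> {}"
    using C by (intro connected_Int_frontier) auto
  then obtain t where "t \<in> {0..1}" "f (\<gamma> t) \<in> frontier C" by blast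
  then show ?thesis using \<gamma>(4) by (intro bexI[of _ "\<gamma> t"]) auto
qed

text \<open>
  Some disc of the chain starts in \<open>C\<close> and ends outside it. Its geodesic segment meets the frontier
  of \<open>C\<close>, and cutting the chain there splits its length additively.
\<close>

lemma chain_crosses_frontier:
  assumes M: "Metric_space \<Omega> (kobayashi A \<Omega>)"
    and "disc_chain A \<Omega> x y l" and "x \<in> C" "y \<notin> C"
  shows "\<exists>z\<in>frontier C. z \<in> \<Omega> \<and> kobayashi A \<Omega> x z + kobayashi A \<Omega> z y \<le> l"
  using assms(2-)
proof (induction rule: disc_chain.induct)
  case (disc_chain_disc f a b)
  obtain c where c: "c \<in> ball 0 1" "f c \<in> frontier C" "poincare_dist a c + poincare_dist c b = poincare_dist a b"
    using disc_crosses_frontier[of A \<Omega> f a b C] disc_chain_disc by blast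
  have "kobayashi A \<Omega> (f a) (f c) \<le> poincare_dist a c" "kobayashi A \<Omega> (f c) (f b) \<le> poincare_dist c b"
    using disc_chain_disc c by (auto intro!: kobayashi_le_poincare)
  then show ?case
    using c holomorphic_disc_in[OF disc_chain_disc(1) c(1)] by (intro bexI[of _ "f c"]) auto
next
  case (disc_chain_snoc x f a l b)
  interpret Metric_space \<Omega> "kobayashi A \<Omega>" by fact
  have fin: "f a \<in> \<Omega>" "f b \<in> \<Omega>"
    using disc_chain_snoc.hyps holomorphic_disc_in by blast+
  show ?case
  proof (cases "f a \<in> C")
    case True
    obtain c where c: "c \<in> ball 0 1" "f c \<in> frontier C" "poincare_dist a c + poincare_dist c b = poincare_dist a b"
      using disc_crosses_frontier[of A \<Omega> f a b C] disc_chain_snoc.hyps disc_chain_snoc.prems True by blast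
    have "kobayashi A \<Omega> (f c) (f b) \<le> poincare_dist c b"
      using disc_chain_snoc c by (auto intro!: kobayashi_le_poincare)
    moreover have "kobayashi A \<Omega> x (f c) \<le> l + poincare_dist a c"
      using disc_chain_snoc c by (intro kobayashi_le_chain disc_chain.disc_chain_snoc)
    ultimately show ?thesis
      using c holomorphic_disc_in[OF disc_chain_snoc.hyps(2) c(1)] by (intro bexI[of _ "f c"]) auto
  next
    case False
    then obtain z where z: "z \<in> frontier C" "z \<in> \<Omega>" "kobayashi A \<Omega> x z + kobayashi A \<Omega> z (f a) \<le> l"
      using disc_chain_snoc.IH disc_chain_snoc.prems by blast
    have "kobayashi A \<Omega> z (f b) \<le> kobayashi A \<Omega> z (f a) + kobayashi A \<Omega> (f a) (f b)"
      using z fin by (intro triangle) auto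
    moreover have "kobayashi A \<Omega> (f a) (f b) \<le> poincare_dist a b"
      using disc_chain_snoc by (intro kobayashi_le_poincare)
    ultimately show ?thesis using z by (intro bexI[of _ z]) auto
  qed
qed

section \<open>Discs in charts\<close>

lemma homeomorphism_open_image_Int:
  assumes "homeomorphism U V \<phi> g" "open V" "open T"
  shows "open (\<phi> ` (U \<inter> T))"
proof -
  have "\<phi> ` (U \<inter> T) = V \<inter> g -` T"
    using assms(1) by (auto simp: homeomorphism_def)
  then show ?thesis
    using assms continuous_open_preimage[of V g T] by (auto simp: homeomorphism_def)
qed

lemma atlas_chart_at:
  fixes A :: "('a::{t2_space, second_countable_topology} set \<times> ('a \<Rightarrow> complex ^ 'n)) set" and \<Omega> :: "'a set"
  assumes "complex_atlas A" "open \<Omega>" "x \<in> \<Omega>"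
  obtains U \<phi> r where "(U, \<phi>) \<in> A" "open U" "x \<in> U" "homeomorphism U (\<phi> ` U) \<phi> (inv_into U \<phi>)"
    "r > 0" "ball (\<phi> x) r \<subseteq> \<phi> ` (U \<inter> \<Omega>)"
proof -
  have "x \<in> (\<Union>(U, \<phi>)\<in>A. U)"
    using assms(1) unfolding complex_atlas_def by simp
  then obtain U \<phi> where U: "(U, \<phi>) \<in> A" "x \<in> U" by blast
  then have *: "open U" "open (\<phi> ` U)" "homeomorphism U (\<phi> ` U) \<phi> (inv_into U \<phi>)"
    using assms(1) unfolding complex_atlas_def by fast+
  then have "open (\<phi> ` (U \<inter> \<Omega>))"
    using homeomorphism_open_image_Int assms(2) by blast
  then obtain r where "r > 0" "ball (\<phi> x) r \<subseteq> \<phi> ` (U \<inter> \<Omega>)"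
    using U assms(3) by (metis IntI imageI open_contains_ball)
  then show ?thesis using that U * by blast
qed

lemma norm_vector_scalar_mult: "norm (c *s v) = norm c * norm (v :: complex ^ 'n)"
  by (simp add: norm_vec_def norm_mult L2_set_right_distrib)

text \<open>
  A complex affine disc in the image of a chart is a holomorphic disc of the manifold: the transition
  maps have complex linear derivatives, hence are holomorphic along complex lines.
\<close>

lemma holomorphic_disc_in_chart:
  fixes A :: "('a::{t2_space, second_countable_topology} set \<times> ('a \<Rightarrow> complex ^ 'n)) set" and \<Omega> :: "'a set"
  assumes A: "complex_atlas A" and U: "(U, \<phi>) \<in> A"
    and h: "homeomorphism U (\<phi> ` U) \<phi> (inv_into U \<phi>)"
    and r: "ball p r \<subseteq> \<phi> ` (U \<inter> \<Omega>)" and v: "norm v \<le> r" "r > 0"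
  shows "holomorphic_disc A \<Omega> (\<lambda>z. inv_into U \<phi> (p + z *s v))"
proof -
  define g where "g = inv_into U \<phi>"
  define L where "L = (\<lambda>z::complex. p + z *s v)"
  have inj: "g (\<phi> y) = y" if "y \<in> U" for y
    using h that by (simp add: homeomorphism_def g_def)
  have Lin: "L z \<in> \<phi> ` (U \<inter> \<Omega>)" if "z \<in> ball 0 1" for z
  proof -
    have "norm z * norm v < r"
      using that v by (cases "v = 0") (auto intro!: less_le_trans[OF mult_strict_right_mono])
    then have "L z \<in> ball p r"
      by (simp add: L_def dist_norm norm_vector_scalar_mult)
    then show ?thesis using r by blast
  qed
  have lin: "linear (\<lambda>z::complex. z *s v)"
    by (rule linearI) (simp_all add: vec_eq_iff algebra_simps)
  have Lder: "(L has_derivative (\<lambda>z. z *s v)) (at z)" for z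
    unfolding L_def using linear_imp_has_derivative[OF lin, of "at z"]
    by (auto intro!: derivative_eq_intros)
  have Lcont: "continuous_on T L" for T
    by (rule has_derivative_continuous_on[OF has_derivative_at_withinI[OF Lder]])
  have gin: "g (L z) \<in> U \<inter> \<Omega>" if z: "z \<in> ball 0 1" for z
  proof -
    obtain y where "y \<in> U" "y \<in> \<Omega>" "L z = \<phi> y" using Lin[OF z] by blast
    then show ?thesis using inj by simp
  qed
  have cont: "continuous_on (ball 0 1) (\<lambda>z. g (L z))"
  proof (rule continuous_on_compose2[of "\<phi> ` U" g])
    show "continuous_on (\<phi> ` U) g" using h by (simp add: homeomorphism_def g_def)
    show "L ` ball 0 1 \<subseteq> \<phi> ` U" using Lin by blast
  qed (rule Lcont)
  have "(\<lambda>z. \<psi> (g (L z)) $ i) holomorphic_on {z \<in> ball 0 1. g (L z) \<in> W}"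
    if W: "(W, \<psi>) \<in> A" for W and \<psi> :: "'a \<Rightarrow> complex ^ 'n" and i
  proof -
    have oW: "open W" using A W unfolding complex_atlas_def by fast
    have hol: "holomorphic_vec_on (\<psi> \<circ> g) (\<phi> ` (U \<inter> W))"
      using A U W unfolding complex_atlas_def g_def by fast
    have eq: "{z \<in> ball 0 1. g (L z) \<in> W} = ball 0 1 \<inter> (\<lambda>z. g (L z)) -` W" by auto
    have op: "open {z \<in> ball 0 1. g (L z) \<in> W}"
      unfolding eq using cont oW by (intro continuous_open_preimage) auto
    have "\<exists>D. ((\<lambda>z. \<psi> (g (L z)) $ i) has_field_derivative D) (at z)"
      if z: "z \<in> ball 0 1" "g (L z) \<in> W" for z
    proof -
      have "L z = \<phi> (g (L z))"
        using Lin[OF z(1)] inj by (metis IntD1 imageE)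
      then have "L z \<in> \<phi> ` (U \<inter> W)" using gin[OF z(1)] z(2) by blast
      then obtain f' where f': "((\<psi> \<circ> g) has_derivative f') (at (L z))" "\<And>c v. f' (c *s v) = c *s f' v"
        using hol unfolding holomorphic_vec_on_def by blast
      have "((\<lambda>z. (\<psi> \<circ> g) (L z)) has_derivative (\<lambda>h. f' (h *s v))) (at z)"
        using has_derivative_compose[OF Lder f'(1)] .
      then have "((\<lambda>z. (\<psi> \<circ> g) (L z) $ i) has_derivative (\<lambda>h. f' (h *s v) $ i)) (at z)"
        by (rule bounded_linear.has_derivative[OF bounded_linear_vec_nth])
      moreover have "(\<lambda>h. f' (h *s v) $ i) = (*) (f' v $ i)"
        by (rule ext) (simp add: f'(2) mult.commute)
      ultimately show ?thesis
        by (auto simp: has_field_derivative_def o_def)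
    qed
    then show ?thesis
      using holomorphic_on_open[OF op] by blast
  qed
  then show ?thesis
    using cont gin unfolding holomorphic_disc_def g_def L_def by blast
qed

text \<open>
  Points near \<open>x\<close> lie on one disc through \<open>x\<close>, at small Poincare distance from its centre. This gives
  both the continuity of the Kobayashi distance and the existence of chains.
\<close>

lemma nearby_points_in_disc:
  fixes A :: "('a::{t2_space, second_countable_topology} set \<times> ('a \<Rightarrow> complex ^ 'n)) set" and \<Omega> :: "'a set"
  assumes A: "complex_atlas A" and \<Omega>: "open \<Omega>" "x \<in> \<Omega>" and e: "e > 0"
  obtains V where "open V" "x \<in> V" "V \<subseteq> \<Omega>"
    "\<forall>y\<in>V. \<exists>f b. holomorphic_disc A \<Omega> f \<and> b \<in> ball 0 1 \<and> f 0 = x \<and> f b = y \<and> poincare_dist 0 b < e"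
proof -
  obtain U \<phi> r where U: "(U, \<phi>) \<in> A" "open U" "x \<in> U" 
    and h: "homeomorphism U (\<phi> ` U) \<phi> (inv_into U \<phi>)"
    and r: "r > 0" "ball (\<phi> x) r \<subseteq> \<phi> ` (U \<inter> \<Omega>)"
    by (rule atlas_chart_at[OF A \<Omega>])
  have "((\<lambda>t::real. artanh t) \<longlongrightarrow> artanh 0) (at 0)"
    by (intro tendsto_intros) auto
  then have "eventually (\<lambda>t::real. dist (artanh t) 0 < e) (at 0)"
    using e by (simp add: tendsto_iff)
  then obtain d where d: "d > 0" "\<And>t::real. t \<noteq> 0 \<Longrightarrow> \<bar>t\<bar> < d \<Longrightarrow> \<bar>artanh t\<bar> < e"
    by (auto simp: eventually_at dist_real_def)
  have contphi: "continuous_on (U \<inter> \<Omega>) \<phi>"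
    using h by (auto simp: homeomorphism_def intro: continuous_on_subset)
  define V where "V = (U \<inter> \<Omega>) \<inter> \<phi> -` ball (\<phi> x) (min 1 d * r)"
  have "open V" unfolding V_def using U \<Omega> contphi by (intro continuous_open_preimage) auto
  moreover have "x \<in> V" "V \<subseteq> \<Omega>" unfolding V_def using U \<Omega> d(1) r(1) by auto
  moreover have "\<exists>f b. holomorphic_disc A \<Omega> f \<and> b \<in> ball 0 1 \<and> f 0 = x \<and> f b = y \<and> poincare_dist 0 b < e"
    if y: "y \<in> V" for y
  proof -
    define s where "s = norm (\<phi> y - \<phi> x)"
    \<comment> \<open>The disc of radius \<open>r\<close> in the direction of \<open>y\<close>; it degenerates to a point if \<open>s = 0\<close>.\<close>
    define v where "v = of_real (r / s) *s (\<phi> y - \<phi> x)"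
    have s: "0 \<le> s" "s < min 1 d * r"
      using y by (auto simp: V_def s_def dist_norm norm_minus_commute)
    have "norm v \<le> r"
      unfolding v_def norm_vector_scalar_mult using r s(1) by (auto simp: s_def norm_divide)
    then have "holomorphic_disc A \<Omega> (\<lambda>z. inv_into U \<phi> (\<phi> x + z *s v))" (is "holomorphic_disc A \<Omega> ?f")
      using A U(1) h r by (intro holomorphic_disc_in_chart)
    moreover have "inv_into U \<phi> (\<phi> x + 0 *s v) = x"
      using h U(3) by (simp add: homeomorphism_def)
    moreover have "of_real (s / r) *s v = \<phi> y - \<phi> x"
      using r by (cases "s = 0") (auto simp: v_def s_def)
    then have "inv_into U \<phi> (\<phi> x + of_real (s / r) *s v) = y"
      using h y by (simp add: homeomorphism_def V_def)
    moreover have sr: "s / r < 1" "s / r < d" "s / r \<ge> 0"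
      using s r by (auto simp: pos_divide_less_eq min_def mult.commute split: if_splits intro: less_le_trans)
    then have "complex_of_real (s / r) \<in> ball 0 1"
      using s by (simp add: norm_divide)
    moreover have "artanh (s / r) < e"
      using d(2)[of "s / r"] sr e abs_of_nonneg[OF sr(3)] by (cases "s / r = 0") (simp only: artanh_0, linarith)
    then have "poincare_dist 0 (of_real (s / r)) < e"
      using sr s r by (simp add: poincare_dist_def norm_divide)
    ultimately show ?thesis
      by (intro exI[of _ ?f] exI[of _ "of_real (s / r)"]) blast
  qed
  ultimately show ?thesis using that by blast
qed

lemma atlas_compact_neighbourhood:
  fixes A :: "('a::{t2_space, second_countable_topology} set \<times> ('a \<Rightarrow> complex ^ 'n)) set" and \<Omega> :: "'a set"
  assumes A: "complex_atlas A" and \<Omega>: "open \<Omega>" "x \<in> \<Omega>"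
  shows "\<exists>V C. open V \<and> compact C \<and> (x::'a) \<in> V \<and> V \<subseteq> C \<and> C \<subseteq> \<Omega>"
proof -
  obtain U \<phi> r where U: "(U, \<phi>) \<in> A" "open U" "x \<in> U" 
    and h: "homeomorphism U (\<phi> ` U) \<phi> (inv_into U \<phi>)"
    and r: "r > 0" "ball (\<phi> x) r \<subseteq> \<phi> ` (U \<inter> \<Omega>)"
    by (rule atlas_chart_at[OF A \<Omega>])
  define C where "C = inv_into U \<phi> ` cball (\<phi> x) (r/2)"
  define V where "V = U \<inter> \<phi> -` ball (\<phi> x) (r/2)"
  have sub: "cball (\<phi> x) (r/2) \<subseteq> \<phi> ` (U \<inter> \<Omega>)" using r by force
  have "compact C"
    unfolding C_def
  proof (rule compact_continuous_image)
    show "continuous_on (cball (\<phi> x) (r / 2)) (inv_into U \<phi>)"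
      using h sub by (auto simp: homeomorphism_def intro!: continuous_on_subset[of "\<phi> ` U"])
  qed simp
  moreover have "open V"
    unfolding V_def using U h by (intro continuous_open_preimage) (auto simp: homeomorphism_def)
  moreover have "x \<in> V" using U r by (simp add: V_def)
  moreover have "V \<subseteq> C"
  proof
    fix y assume "y \<in> V"
    then show "y \<in> C"
      using h unfolding C_def V_def by (intro image_eqI[of _ _ "\<phi> y"]) (auto simp: homeomorphism_def)
  qed
  moreover have "C \<subseteq> \<Omega>"
    unfolding C_def using sub h by (force simp: homeomorphism_def)
  ultimately show ?thesis by blast
qed

lemma kobayashi_small_near:
  fixes A :: "('a::{t2_space, second_countable_topology} set \<times> ('a \<Rightarrow> complex ^ 'n)) set" and \<Omega> :: "'a set"
  assumes "complex_atlas A" and "open \<Omega>" "x \<in> \<Omega>" and "e > 0"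
  shows "\<exists>V. open V \<and> x \<in> V \<and> V \<subseteq> \<Omega> \<and> (\<forall>y\<in>V. kobayashi A \<Omega> x y < e)"
proof -
  obtain V where V: "open V" "x \<in> V" "V \<subseteq> \<Omega>"
    "\<forall>y\<in>V. \<exists>f b. holomorphic_disc A \<Omega> f \<and> b \<in> ball 0 1 \<and> f 0 = x \<and> f b = y \<and> poincare_dist 0 b < e"
    by (rule nearby_points_in_disc[OF assms])
  have "kobayashi A \<Omega> x y < e" if y: "y \<in> V" for y
  proof -
    obtain f b where "holomorphic_disc A \<Omega> f" "b \<in> ball 0 1" "f 0 = x" "f b = y" "poincare_dist 0 b < e"
      using bspec[OF V(4) y] by blast
    then show ?thesis using kobayashi_le_poincare[of A \<Omega> f 0 b] by simp
  qed
  then show ?thesis using V by blast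
qed

text \<open>
  The set of points reachable from \<open>x\<close> is open and closed in the connected set \<open>\<Omega>\<close>.
\<close>

lemma disc_chain_exists:
  fixes A :: "('a::{t2_space, second_countable_topology} set \<times> ('a \<Rightarrow> complex ^ 'n)) set" and \<Omega> :: "'a set"
  assumes A: "complex_atlas A" and \<Omega>: "open \<Omega>" "connected \<Omega>" and x: "x \<in> \<Omega>" and y: "y \<in> \<Omega>"
  shows "\<exists>l. disc_chain A \<Omega> x y l"
proof -
  define R where "R = {z \<in> \<Omega>. \<exists>l. disc_chain A \<Omega> x z l}"
  have near: "\<exists>V. open V \<and> z \<in> V \<and> V \<subseteq> \<Omega> \<and> (\<forall>w\<in>V. w \<in> R \<longleftrightarrow> z \<in> R)" if z: "z \<in> \<Omega>" for z
  proof -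
    obtain V where V: "open V" "z \<in> V" "V \<subseteq> \<Omega>"
      "\<forall>w\<in>V. \<exists>f b. holomorphic_disc A \<Omega> f \<and> b \<in> ball 0 1 \<and> f 0 = z \<and> f b = w \<and> poincare_dist 0 b < 1"
      by (rule nearby_points_in_disc[OF A \<Omega>(1) z zero_less_one])
    have "w \<in> R \<longleftrightarrow> z \<in> R" if w: "w \<in> V" for w
    proof -
      obtain f b where f: "holomorphic_disc A \<Omega> f" "b \<in> ball 0 1" "f 0 = z" "f b = w"
        using V(4) w by meson
      have "0 \<in> ball (0::complex) 1" by simp
      then have "disc_chain A \<Omega> x z l \<Longrightarrow> disc_chain A \<Omega> x w (l + poincare_dist 0 b)"
        "disc_chain A \<Omega> x w l \<Longrightarrow> disc_chain A \<Omega> x z (l + poincare_dist b 0)" for l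
        using f disc_chain_snoc[of A \<Omega> x f 0 l b] disc_chain_snoc[of A \<Omega> x f b l 0] by auto
      then show ?thesis using z w V(3) unfolding R_def by blast
    qed
    then show ?thesis using V by blast
  qed
  have "x \<in> R"
  proof -
    obtain V where "open V" "x \<in> V" "V \<subseteq> \<Omega>"
      "\<forall>w\<in>V. \<exists>f b. holomorphic_disc A \<Omega> f \<and> b \<in> ball 0 1 \<and> f 0 = x \<and> f b = w \<and> poincare_dist 0 b < 1"
      by (rule nearby_points_in_disc[OF A \<Omega>(1) x zero_less_one])
    then obtain f where f: "holomorphic_disc A \<Omega> f" "f 0 = x" by meson
    then show ?thesis
      using disc_chain_disc[OF f(1), of 0 0] x unfolding R_def by auto
  qed
  moreover have "open R"
  proof (subst open_subopen, intro ballI)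
    fix z assume z: "z \<in> R"
    then have "z \<in> \<Omega>" by (simp add: R_def)
    from near[OF this] z show "\<exists>T. open T \<and> z \<in> T \<and> T \<subseteq> R" by blast
  qed
  moreover have "open (\<Omega> - R)"
  proof (subst open_subopen, intro ballI)
    fix z assume z: "z \<in> \<Omega> - R"
    then have "z \<in> \<Omega>" by simp
    from near[OF this] z show "\<exists>T. open T \<and> z \<in> T \<and> T \<subseteq> \<Omega> - R" by blast
  qed
  ultimately have "\<Omega> - R = {}"
    using connectedD[OF \<Omega>(2) \<open>open R\<close> \<open>open (\<Omega> - R)\<close>] x by blast
  then show ?thesis using y unfolding R_def by blast
qed

text \<open>
  The Kobayashi distance is a length distance: almost shortest connections cannot jump over a frontier.
\<close>

lemma kobayashi_crosses_frontier:
  fixes A :: "('a::{t2_space, second_countable_topology} set \<times> ('a \<Rightarrow> complex ^ 'n)) set" and \<Omega> :: "'a set"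
  assumes A: "complex_atlas A" and \<Omega>: "open \<Omega>" "connected \<Omega>"
    and M: "Metric_space \<Omega> (kobayashi A \<Omega>)"
    and xy: "x \<in> \<Omega>" "y \<in> \<Omega>" "x \<in> C" "y \<notin> C" and e: "e > 0"
  shows "\<exists>z\<in>frontier C. z \<in> \<Omega> \<and> kobayashi A \<Omega> x z + kobayashi A \<Omega> z y < kobayashi A \<Omega> x y + e"
proof -
  have "{l. disc_chain A \<Omega> x y l} \<noteq> {}"
    using disc_chain_exists[OF A \<Omega>] xy by blast
  moreover have "kobayashi A \<Omega> x y = Inf {l. disc_chain A \<Omega> x y l}"
    using xy by (simp add: kobayashi_def disc_chain_lengths_eq)
  ultimately obtain l where "disc_chain A \<Omega> x y l" "l < kobayashi A \<Omega> x y + e"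
    using cInf_lessD[of "{l. disc_chain A \<Omega> x y l}" "kobayashi A \<Omega> x y + e"] e by auto
  then show ?thesis
    using chain_crosses_frontier[OF M _ xy(3,4)] by fastforce
qed

section \<open>The end compactification\<close>

lemma limitin_end_compactification:
  "limitin (end_compactification S K) f l F \<longleftrightarrow>
     l \<in> Inl ` S \<union> Inr ` ends S K \<and> (\<forall>W. end_open S K W \<and> l \<in> W \<longrightarrow> eventually (\<lambda>n. f n \<in> W) F)"
  by (simp add: limitin_def openin_end_compactification topspace_end_compactification)

lemma end_open_Inl: "open U \<Longrightarrow> end_open S K (Inl ` (U \<inter> S))"
  unfolding end_open_def by (auto simp: image_iff)

lemma limitin_Inl_iff:
  assumes "x \<in> S" "\<And>n. s n \<in> S"
  shows "limitin (end_compactification S K) (\<lambda>n. Inl (s n)) (Inl x) F \<longleftrightarrow> (s \<longlongrightarrow> x) F"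
proof
  assume L: "limitin (end_compactification S K) (\<lambda>n. Inl (s n)) (Inl x) F"
  show "(s \<longlongrightarrow> x) F"
  proof (rule topological_tendstoI)
    fix U assume "open U" "x \<in> U"
    then have "eventually (\<lambda>n. Inl (s n) \<in> (Inl ` (U \<inter> S) :: ('a + (nat \<Rightarrow> 'a set)) set)) F"
      using L[unfolded limitin_end_compactification, THEN conjunct2, rule_format, of "Inl ` (U \<inter> S)"]
        end_open_Inl[of U S K] assms(1) by simp
    then show "eventually (\<lambda>n. s n \<in> U) F" by (rule eventually_mono) auto
  qed
next
  assume L: "(s \<longlongrightarrow> x) F"
  show "limitin (end_compactification S K) (\<lambda>n. Inl (s n)) (Inl x) F"
    unfolding limitin_end_compactification
  proof (intro conjI allI impI)
    fix W :: "('a + _) set" assume W: "end_open S K W \<and> Inl x \<in> W"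
    then obtain U where U: "open U" "x \<in> U" "Inl ` (U \<inter> S) \<subseteq> W"
      unfolding end_open_def by meson
    have "eventually (\<lambda>n. s n \<in> U) F" using L U by (simp add: topological_tendstoD)
    then show "eventually (\<lambda>n. Inl (s n) \<in> W) F"
      by (rule eventually_mono) (use U assms in auto)
  qed (use assms in auto)
qed

locale exhausted =
  fixes S :: "'a::t2_space set" and K :: "nat \<Rightarrow> 'a set"
  assumes exhaustion: "compact_exhaustion S K"
begin

lemma compact_K: "compact (K j)"
  using exhaustion by (simp add: compact_exhaustion_def)

lemma closed_K: "closed (K j)"
  by (rule compact_imp_closed[OF compact_K])

lemma K_mono: "i \<le> j \<Longrightarrow> K i \<subseteq> K j"
proof (rule lift_Suc_mono_le)
  show "K n \<subseteq> K (Suc n)" for n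
    using exhaustion interior_of_subset[of "top_of_set S" "K (Suc n)"]
    unfolding compact_exhaustion_def by blast
qed

lemma in_some_K: "x \<in> S \<Longrightarrow> \<exists>j. x \<in> K j"
  using exhaustion unfolding compact_exhaustion_def by blast

lemma K_neighbourhood:
  assumes "x \<in> S"
  obtains U m where "open U" "x \<in> U" "U \<inter> S \<subseteq> K m"
proof -
  obtain j where "x \<in> K j" using in_some_K[OF assms] by blast
  then have "x \<in> top_of_set S interior_of K (Suc j)"
    using exhaustion unfolding compact_exhaustion_def by blast
  then obtain T where "openin (top_of_set S) T" "x \<in> T" "T \<subseteq> K (Suc j)"
    unfolding interior_of_def by blast
  then show ?thesis
    using that[of _ "Suc j"] by (auto simp: openin_open Int_commute)
qed

lemma ends_component: "F \<in> ends S K \<Longrightarrow> F j \<in> components (S - K j)"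
  by (simp add: ends_def)

lemma ends_subset: "F \<in> ends S K \<Longrightarrow> F j \<subseteq> S - K j"
  using ends_component in_components_subset by blast

lemma ends_nonempty: "F \<in> ends S K \<Longrightarrow> F j \<noteq> {}"
  using ends_component in_components_nonempty by blast

lemma ends_antimono: "F \<in> ends S K \<Longrightarrow> i \<le> j \<Longrightarrow> F j \<subseteq> F i"
  by (rule lift_Suc_antimono_le[of F]) (auto simp: ends_def)

lemma ends_eq_of_meet:
  assumes "F \<in> ends S K" "G \<in> ends S K" "x \<in> F j" "x \<in> G j"
  shows "F j = G j"
  using components_eq[OF ends_component[OF assms(1)] ends_component[OF assms(2)]] assms(3,4)
  by blast

text \<open>
  In the topology of \<^const>\<open>end_compactification\<close> the basic sets \<^const>\<open>end_nbhd\<close> might fail to be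
  neighbourhoods, so a convergent escaping sequence might avoid the basic sets of its limit. It cannot
  avoid those of every end: the complement of the sequence would then be an open set that contains the
  limit.
\<close>

lemma escaping_clusters_at_end:
  assumes t: "\<And>n. t n \<in> S - K n"
    and lim: "limitin (end_compactification S K) (\<lambda>n. Inl (t n)) l sequentially"
  shows "\<exists>H\<in>ends S K. \<forall>k. \<exists>n. t n \<in> H k"
proof (rule ccontr)
  assume "\<not> ?thesis"
  then have none: "\<exists>k. \<forall>n. t n \<notin> H k" if "H \<in> ends S K" for H using that by blast
  have tK: "n < m" if "t n \<in> K m" for n m
    using t[of n] K_mono[of m n] that by force
  define W where "W = (Inl ` S \<union> Inr ` ends S K) - Inl ` range t"
  have "end_open S K W"
    unfolding end_open_def
  proof (intro conjI allI impI)
    show "W \<subseteq> Inl ` S \<union> Inr ` ends S K" by (auto simp: W_def)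
  next
    fix x :: 'a assume "Inl x \<in> W"
    then have x: "x \<in> S" "x \<notin> range t" by (auto simp: W_def)
    obtain U m where U: "open U" "x \<in> U" "U \<inter> S \<subseteq> K m" by (rule K_neighbourhood[OF x(1)])
    have "open (U - t ` {..<m})"
      using U(1) by (intro open_Diff finite_imp_closed) auto
    moreover have "Inl ` ((U - t ` {..<m}) \<inter> S) \<subseteq> W"
      using U(3) tK by (auto simp: W_def)
    ultimately show "\<exists>U. open U \<and> x \<in> U \<and> Inl ` (U \<inter> S) \<subseteq> W"
      using U(2) x(2) by (intro exI[of _ "U - t ` {..<m}"]) auto
  next
    fix F assume "Inr F \<in> W"
    then have F: "F \<in> ends S K" by (auto simp: W_def)
    then obtain k where "\<forall>n. t n \<notin> F k" using none by blast
    then have "end_nbhd S K F k \<subseteq> W"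
      using ends_subset[OF F, of k] unfolding end_nbhd_def W_def by auto
    then show "\<exists>j. end_nbhd S K F j \<subseteq> W" by blast
  qed
  moreover have "l \<in> W"
  proof -
    have "l \<notin> Inl ` S"
    proof
      assume "l \<in> Inl ` S"
      then obtain y where y: "l = Inl y" "y \<in> S" by blast
      obtain U m where U: "open U" "y \<in> U" "U \<inter> S \<subseteq> K m" by (rule K_neighbourhood[OF y(2)])
      have "t \<longlonglongrightarrow> y" using lim limitin_Inl_iff[of y S t K] y t by auto
      then have "eventually (\<lambda>n. t n \<in> U) sequentially" using U by (simp add: topological_tendstoD)
      then have "eventually (\<lambda>n. n < m) sequentially"
        by (rule eventually_mono) (use U t tK in blast)
      then show False by (metis eventually_sequentially less_irrefl less_or_eq_imp_le linorder_le_cases)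
    qed
    then show ?thesis using lim t unfolding limitin_end_compactification W_def by auto
  qed
  ultimately have "eventually (\<lambda>n. Inl (t n) \<in> W) sequentially"
    using lim unfolding limitin_end_compactification by blast
  then show False by (simp add: W_def)
qed

end

locale seq_compact_ends = exhausted +
  assumes seq_compact: "seq_compact_space (end_compactification S K)"
begin

text \<open>
  A subsequence that enters the components of an end one after the other is a notion of convergence
  that does not depend on the topology at the ends.
\<close>

lemma escaping_subsequence:
  assumes s: "\<And>n. s n \<in> S - K n"
  obtains H r where "H \<in> ends S K" "strict_mono (r :: nat \<Rightarrow> nat)" "\<forall>i. s (r i) \<in> H i"
proof -
  have "range (\<lambda>n. Inl (s n)) \<subseteq> topspace (end_compactification S K)"
    using s by (auto simp: topspace_end_compactification)
  then obtain l q where q: "strict_mono (q :: nat \<Rightarrow> nat)"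
    "limitin (end_compactification S K) ((\<lambda>n. Inl (s n)) \<circ> q) l sequentially"
    using seq_compact unfolding seq_compact_space_def by blast
  have qK: "s (q n) \<in> S - K n" for n
    using s[of "q n"] K_mono[OF seq_suble[OF q(1), of n]] by blast
  then obtain H where H: "H \<in> ends S K" "\<And>k. \<exists>n. s (q n) \<in> H k"
    using escaping_clusters_at_end[of "s \<circ> q" l] q(2) by (auto simp: o_def)
  have late: "\<exists>n>N. s n \<in> H k" for N k
  proof -
    have "\<forall>n. \<exists>m. s n \<in> K m" using in_some_K s by blast
    then obtain m where m: "\<And>n. s n \<in> K (m n)" by metis
    \<comment> \<open>The component \<open>H k'\<close> misses the points \<open>s 0, \<dots>, s N\<close>, which all lie in \<open>K k'\<close>.\<close>
    define k' where "k' = Max (insert k (m ` {..N}))"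
    obtain n where n: "s (q n) \<in> H k'" using H(2) by blast
    have "\<not> q n \<le> N"
    proof
      assume "q n \<le> N"
      then have "m (q n) \<le> k'" unfolding k'_def by (intro Max_ge) auto
      then have "s (q n) \<in> K k'" using m K_mono by blast
      then show False using n ends_subset[OF H(1)] by blast
    qed
    moreover have "k \<le> k'" unfolding k'_def by simp
    ultimately show ?thesis using n ends_antimono[OF H(1)] by (metis not_le subsetD)
  qed
  obtain r where r: "\<forall>i. s (r i) \<in> H i" "\<forall>i. r i < r (Suc i)"
    using dependent_nat_choice[of "\<lambda>i n. s n \<in> H i" "\<lambda>i n n'. n < n'"] late by blast
  then show ?thesis
    using that[of H r] H(1) by (simp add: strict_mono_Suc_iff)
qed

text \<open>
  Otherwise choose infinitely many ends with different components at level \<open>j\<close>, and a point far out in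
  each of them. A subsequence would enter a single component at level \<open>j\<close>.
\<close>

lemma finite_end_components: "finite ((\<lambda>F. F j) ` ends S K)"
proof (rule ccontr)
  assume "infinite ((\<lambda>F. F j) ` ends S K)"
  then obtain c :: "nat \<Rightarrow> _" where c: "inj c" "range c \<subseteq> ((\<lambda>F. F j) ` ends S K)"
    using infinite_countable_subset by blast
  then have "\<forall>n. \<exists>F. F \<in> ends S K \<and> c n = F j" by blast
  then obtain F where F: "\<And>n. F n \<in> ends S K" "\<And>n. c n = F n j" by metis
  \<comment> \<open>Level \<open>n + j\<close> is beyond \<open>K n\<close> and still inside the component at level \<open>j\<close>.\<close>
  have "\<forall>n. \<exists>z. z \<in> F n (n + j)" using ends_nonempty[OF F(1)] by blast
  then obtain z where z: "\<And>n. z n \<in> F n (n + j)" by metis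
  have zK: "z n \<in> S - K n" for n
    using ends_subset[OF F(1)[of n], of "n + j"] z[of n] K_mono[of n "n + j"] by auto
  obtain H r where H: "H \<in> ends S K" "strict_mono (r :: nat \<Rightarrow> nat)" "\<forall>i. z (r i) \<in> H i"
    by (rule escaping_subsequence[OF zK])
  have "c (r i) = H j" if "j \<le> i" for i
  proof -
    have "z (r i) \<in> H j" using H(3) ends_antimono[OF H(1) that] by blast
    moreover have "z (r i) \<in> F (r i) j" using z ends_antimono[OF F(1), of j "r i + j"] by force
    ultimately show ?thesis using ends_eq_of_meet[OF F(1) H(1)] F(2) by metis
  qed
  then have "c (r j) = c (r (Suc j))" by simp
  then have "r j = r (Suc j)" using c(1) by (simp add: inj_eq)
  then show False using H(2) by (simp add: strict_mono_eq)
qed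

lemma complement_subset_end_components:
  obtains M where "M \<ge> j" "S - K M \<subseteq> \<Union>((\<lambda>F. F j) ` ends S K)"
proof -
  define E where "E = (\<Union>F\<in>ends S K. F j)"
  have "\<exists>M. S - K M \<subseteq> E"
  proof (rule ccontr)
    assume "\<not> (\<exists>M. S - K M \<subseteq> E)"
    then have "\<exists>z. z \<in> S - K n \<and> z \<notin> E" for n by (metis subsetI)
    then obtain s where s: "\<And>n. s n \<in> S - K n" "\<And>n. s n \<notin> E" by metis
    obtain H r where "H \<in> ends S K" "strict_mono (r :: nat \<Rightarrow> nat)" "\<forall>i. s (r i) \<in> H i"
      by (rule escaping_subsequence[OF s(1)])
    then have "s (r j) \<in> E" unfolding E_def by blast
    then show False using s(2) by blast
  qed
  then obtain M where "S - K M \<subseteq> E" ..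
  then have "S - K (max M j) \<subseteq> E" using K_mono[of M "max M j"] by auto
  then show ?thesis using that[of "max M j"] unfolding E_def by simp
qed

text \<open>
  Outside a large compact set, a component that carries an end is the complement of the other finitely
  many such components, each of which is relatively closed.
\<close>

lemma end_component_open:
  assumes F: "F \<in> ends S K"
  obtains T M where "open T" "M \<ge> j" "F j - K M = T \<inter> S"
proof -
  obtain M where M: "M \<ge> j" "S - K M \<subseteq> \<Union>((\<lambda>F. F j) ` ends S K)"
    by (rule complement_subset_end_components)
  \<comment> \<open>The other components at level \<open>j\<close> that carry ends.\<close>
  define \<O> where "\<O> = (\<lambda>G. G j) ` ends S K - {F j}"
  have "closedin (top_of_set (S - K j)) (\<Union>\<O>)"
  proof (rule closedin_Union)
    show "finite \<O>" unfolding \<O>_def using finite_end_components by simp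
    fix C assume "C \<in> \<O>"
    then have "C \<in> components (S - K j)" unfolding \<O>_def using ends_component by blast
    then show "closedin (top_of_set (S - K j)) C" by (rule closedin_component)
  qed
  then obtain Z where Z: "closed Z" "\<Union>\<O> = (S - K j) \<inter> Z"
    by (auto simp: closedin_closed)
  have "F j - K M = (- K M \<inter> - Z) \<inter> S"
  proof (intro equalityI subsetI)
    fix x assume x: "x \<in> F j - K M"
    have "x \<notin> \<Union>\<O>"
      using x ends_eq_of_meet[OF F] unfolding \<O>_def by blast
    then show "x \<in> (- K M \<inter> - Z) \<inter> S"
      using x ends_subset[OF F, of j] Z(2) by blast
  next
    fix x assume x: "x \<in> (- K M \<inter> - Z) \<inter> S"
    then have "x \<in> \<Union>((\<lambda>F. F j) ` ends S K)" "x \<notin> \<Union>\<O>"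
      using M(2) Z(2) by blast+
    then show "x \<in> F j - K M" using x unfolding \<O>_def by blast
  qed
  moreover have "open (- K M \<inter> - Z)"
    using Z(1) closed_K by (intro open_Int) auto
  ultimately show ?thesis using that M(1) by blast
qed

text \<open>
  Agreement at level \<open>j\<close> forces agreement at all lower levels, because components are disjoint; so this
  makes the basic sets \<^const>\<open>end_nbhd\<close> neighbourhoods.
\<close>

lemma end_open_neighbourhood:
  assumes F: "F \<in> ends S K"
  obtains W where "end_open S K W" "Inr F \<in> W" "W \<subseteq> Inl ` F j \<union> Inr ` {G \<in> ends S K. G j = F j}"
proof -
  obtain T M where T: "open T" "M \<ge> j" "F j - K M = T \<inter> S"
    by (rule end_component_open[OF F])
  define W where "W = Inl ` (T \<inter> S) \<union> Inr ` {G \<in> ends S K. G j = F j}"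
  have "end_open S K W"
    unfolding end_open_def
  proof (intro conjI allI impI)
    fix G assume "Inr G \<in> W"
    then have G: "G \<in> ends S K" "G j = F j" by (auto simp: W_def)
    have "G M \<subseteq> F j - K M"
      using G ends_antimono[OF G(1) T(2)] ends_subset[OF G(1), of M] by blast
    then have "end_nbhd S K G M \<subseteq> W"
      using T(2,3) G unfolding end_nbhd_def W_def by auto
    then show "\<exists>j. end_nbhd S K G j \<subseteq> W" ..
  next
    fix x :: 'a assume "Inl x \<in> W"
    then show "\<exists>U. open U \<and> x \<in> U \<and> Inl ` (U \<inter> S) \<subseteq> W"
      using T(1) by (intro exI[of _ T]) (auto simp: W_def)
  qed (auto simp: W_def)
  moreover have "Inr F \<in> W" using F by (simp add: W_def)
  moreover have "W \<subseteq> Inl ` F j \<union> Inr ` {G \<in> ends S K. G j = F j}"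
    using T(3) unfolding W_def by blast
  ultimately show ?thesis using that by blast
qed

lemma separate_point_end:
  assumes x: "x \<in> S" and F: "F \<in> ends S K"
  shows "\<exists>U V. end_open S K U \<and> end_open S K V \<and> Inl x \<in> U \<and> Inr F \<in> V \<and> U \<inter> V = {}"
proof -
  obtain U m where U: "open U" "x \<in> U" "U \<inter> S \<subseteq> K m" by (rule K_neighbourhood[OF x])
  obtain W where W: "end_open S K W" "Inr F \<in> W" "W \<subseteq> Inl ` F m \<union> Inr ` {G \<in> ends S K. G m = F m}"
    by (rule end_open_neighbourhood[OF F])
  have "Inl ` (U \<inter> S) \<inter> W = {}"
    using U(3) W(3) ends_subset[OF F, of m] by blast
  then show ?thesis
    using U x W(1,2) end_open_Inl[OF U(1), of S K] by blast
qed

lemma Hausdorff_end_compactification: "Hausdorff_space (end_compactification S K)"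
  unfolding Hausdorff_space_def openin_end_compactification topspace_end_compactification disjnt_def
proof (intro allI impI, elim conjE)
  fix p q :: "'a + (nat \<Rightarrow> 'a set)"
  assume p: "p \<in> Inl ` S \<union> Inr ` ends S K" and q: "q \<in> Inl ` S \<union> Inr ` ends S K" and ne: "p \<noteq> q"
  show "\<exists>U V. end_open S K U \<and> end_open S K V \<and> p \<in> U \<and> q \<in> V \<and> U \<inter> V = {}"
  proof (cases p; cases q)
    fix x y assume xy: "p = Inl x" "q = Inl y"
    then obtain U V where "open U" "open V" "x \<in> U" "y \<in> V" "U \<inter> V = {}"
      using ne hausdorff[of x y] by blast
    then show ?thesis
      using xy p q end_open_Inl[of U S K] end_open_Inl[of V S K]
      by - (rule exI[of _ "Inl ` (U \<inter> S)"], rule exI[of _ "Inl ` (V \<inter> S)"], auto)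
  next
    fix x F assume "p = Inl x" "q = Inr F"
    then show ?thesis using separate_point_end[of x F] p q by (simp add: image_iff)
  next
    fix F x assume Fx: "p = Inr F" "q = Inl x"
    then obtain U V where "end_open S K U" "end_open S K V" "Inl x \<in> U" "Inr F \<in> V" "U \<inter> V = {}"
      using separate_point_end[of x F] p q by auto
    then show ?thesis using Fx by - (rule exI[of _ V], rule exI[of _ U], simp add: Int_commute)
  next
    fix F G assume FG: "p = Inr F" "q = Inr G"
    then have F: "F \<in> ends S K" and G: "G \<in> ends S K" using p q by auto
    obtain j where j: "F j \<noteq> G j" using ne FG by (metis ext)
    obtain U where U: "end_open S K U" "Inr F \<in> U" "U \<subseteq> Inl ` F j \<union> Inr ` {H \<in> ends S K. H j = F j}"
      by (rule end_open_neighbourhood[OF F])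
    obtain V where V: "end_open S K V" "Inr G \<in> V" "V \<subseteq> Inl ` G j \<union> Inr ` {H \<in> ends S K. H j = G j}"
      by (rule end_open_neighbourhood[OF G])
    have "F j \<inter> G j = {}"
    proof (rule equals0I)
      fix x assume "x \<in> F j \<inter> G j"
      then show False using j ends_eq_of_meet[OF F G, of x j] by simp
    qed
    then have "(Inl ` F j \<union> Inr ` {H \<in> ends S K. H j = F j}) \<inter> (Inl ` G j \<union> Inr ` {H \<in> ends S K. H j = G j}) = {}"
      using j by auto
    then have "U \<inter> V = {}" using Int_mono[OF U(3) V(3)] by (metis subset_empty)
    then show ?thesis using U(1,2) V(1,2) FG by - (rule exI[of _ U], rule exI[of _ V], simp)
  qed
qed

lemma end_limit_of_dense_sequence:
  assumes S: "S = closure D" and F: "F \<in> ends S K"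
  obtains s where "range s \<subseteq> D" "limitin (end_compactification S K) (\<lambda>n. Inl (s n)) (Inr F) sequentially"
proof -
  have "\<exists>x. x \<in> D \<inter> F n" for n
  proof -
    obtain T M where T: "open T" "M \<ge> n" "F n - K M = T \<inter> S"
      by (rule end_component_open[OF F])
    have "F M \<subseteq> F n - K M" using ends_antimono[OF F T(2)] ends_subset[OF F, of M] by blast
    then have "T \<inter> closure D \<noteq> {}" using ends_nonempty[OF F, of M] T(3) S by blast
    then have "T \<inter> D \<noteq> {}" using open_Int_closure_eq_empty[OF T(1)] by blast
    then show ?thesis using T(3) S closure_subset[of D] by blast
  qed
  then obtain s where s: "\<And>n. s n \<in> D \<inter> F n" by metis
  have "limitin (end_compactification S K) (\<lambda>n. Inl (s n)) (Inr F) sequentially"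
    unfolding limitin_end_compactification
  proof (intro conjI allI impI)
    fix W assume "end_open S K W \<and> Inr F \<in> W"
    then obtain j where j: "end_nbhd S K F j \<subseteq> W" unfolding end_open_def by meson
    have "Inl (s n) \<in> W" if "n \<ge> j" for n
      using j s[of n] ends_antimono[OF F that] unfolding end_nbhd_def by blast
    then show "eventually (\<lambda>n. Inl (s n) \<in> W) sequentially"
      unfolding eventually_sequentially by blast
  qed (use F in auto)
  then show ?thesis using that s by blast
qed

end

section \<open>Extension of maps from a dense subset\<close>

lemma first_countable_decreasing_base:
  assumes X: "first_countable X" and x: "x \<in> topspace X"
  obtains B :: "nat \<Rightarrow> 'a set" where "\<forall>n. openin X (B n) \<and> x \<in> B n" "decseq B"
    "\<forall>U. openin X U \<and> x \<in> U \<longrightarrow> (\<exists>n. B n \<subseteq> U)"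
proof -
  obtain \<B> where \<B>: "countable \<B>" "\<forall>V \<in> \<B>. openin X V"
    "\<forall>U. openin X U \<and> x \<in> U \<longrightarrow> (\<exists>V \<in> \<B>. x \<in> V \<and> V \<subseteq> U)"
    using X x unfolding first_countable_def by meson
  define \<C> where "\<C> = {V \<in> \<B>. x \<in> V}"
  have "\<C> \<noteq> {}" using \<B>(3) x unfolding \<C>_def by blast
  moreover have "countable \<C>" using \<B>(1) unfolding \<C>_def by simp
  ultimately obtain V :: "nat \<Rightarrow> _" where V: "range V = \<C>"
    by (metis range_from_nat_into)
  have Vn: "openin X (V n)" "x \<in> V n" for n
    using V \<B>(2) unfolding \<C>_def by blast+
  define B where "B = (\<lambda>n. \<Inter>i\<le>n. V i)"
  have "openin X (B n)" for n
    unfolding B_def using Vn by (intro openin_Inter) auto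
  moreover have "x \<in> B n" for n unfolding B_def using Vn by blast
  moreover have "decseq B" unfolding B_def decseq_def by (intro allI impI INT_anti_mono) auto
  moreover have "\<exists>n. B n \<subseteq> U" if U: "openin X U" "x \<in> U" for U
  proof -
    obtain W where W: "W \<in> \<C>" "W \<subseteq> U" using \<B>(3) U unfolding \<C>_def by blast
    then obtain n where "W = V n" using V by blast
    then show ?thesis using W unfolding B_def by blast
  qed
  ultimately show ?thesis by (intro that[of B]) auto
qed

lemma limitin_decreasing_base:
  assumes B: "decseq B" "\<forall>U. openin X U \<and> x \<in> U \<longrightarrow> (\<exists>n. B n \<subseteq> U)" and x: "x \<in> topspace X"
    and s: "\<And>n::nat. s n \<in> B n"
  shows "limitin X s x sequentially"
  unfolding limitin_def eventually_sequentially
proof (intro conjI allI impI x)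
  fix U assume "openin X U \<and> x \<in> U"
  then obtain n where n: "B n \<subseteq> U" using B(2) by blast
  have "s m \<in> U" if "m \<ge> n" for m
    using s[of m] decseqD[OF B(1) that] n by blast
  then show "\<exists>N. \<forall>m\<ge>N. s m \<in> U" by blast
qed

lemma limitin_common_index:
  assumes "limitin X s x sequentially" "openin X U" "x \<in> U" "limitin Y t y sequentially" "openin Y V" "y \<in> V"
  shows "\<exists>n::nat. s n \<in> U \<and> t n \<in> V"
proof -
  have "eventually (\<lambda>n. s n \<in> U \<and> t n \<in> V) sequentially"
    using assms by (intro eventually_conj) (auto simp: limitin_def)
  then show ?thesis by (auto simp: eventually_sequentially)
qed

text \<open>
  For continuity at \<open>\<xi>\<close>, suppose that \<open>\<eta>\<^sub>n \<rightarrow> \<xi>\<close> while \<open>F \<eta>\<^sub>n\<close> stays outside a neighbourhood of \<open>F \<xi>\<close>.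
  Along a subsequence \<open>F \<eta>\<^sub>n\<close> converges to some \<open>l \<noteq> F \<xi>\<close>; replacing each \<open>\<eta>\<^sub>n\<close> by a nearby point of
  \<open>D\<close> whose image is in a neighbourhood of \<open>l\<close> disjoint from one of \<open>F \<xi>\<close> contradicts uniqueness.
\<close>

lemma continuous_extension_of_dense:
  fixes i :: "'d \<Rightarrow> 'x" and j :: "'d \<Rightarrow> 'y"
  assumes X: "first_countable X" and Y: "Hausdorff_space Y" "seq_compact_space Y"
    and dense: "topspace X \<subseteq> X closure_of (i ` D)" and j: "j ` D \<subseteq> topspace Y"
    and unique: "\<And>s t \<xi> l l'. \<lbrakk>range s \<subseteq> D; range t \<subseteq> D;
       limitin X (\<lambda>n. i (s n)) \<xi> sequentially; limitin Y (\<lambda>n. j (s n)) l sequentially;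
       limitin X (\<lambda>n. i (t n)) \<xi> sequentially; limitin Y (\<lambda>n. j (t n)) l' sequentially\<rbrakk> \<Longrightarrow> l = l'"
  obtains F where "continuous_map X Y F"
    "\<forall>s \<xi> l. range s \<subseteq> D \<and> limitin X (\<lambda>n. i (s n)) \<xi> sequentially \<and> limitin Y (\<lambda>n. j (s n)) l sequentially
       \<longrightarrow> F \<xi> = l"
proof -
  define R where "R = (\<lambda>\<xi> l. \<exists>s::nat \<Rightarrow> 'd. range s \<subseteq> D \<and> limitin X (\<lambda>n. i (s n)) \<xi> sequentially
       \<and> limitin Y (\<lambda>n. j (s n)) l sequentially)"
  have R_unique: "l = l'" if "R \<xi> l" "R \<xi> l'" for \<xi> l l'
    using that unique unfolding R_def by blast
  have cluster: "\<exists>r l. strict_mono (r::nat \<Rightarrow> nat) \<and> limitin Y (t \<circ> r) l sequentially"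
    if "\<And>n. t n \<in> topspace Y" for t :: "nat \<Rightarrow> 'y"
    using Y(2) that unfolding seq_compact_space_def by blast
  have subseq: "\<exists>r l. strict_mono (r::nat \<Rightarrow> nat) \<and> limitin Y (\<lambda>n. j (s (r n))) l sequentially \<and> R \<xi> l"
    if s: "range s \<subseteq> D" "limitin X (\<lambda>n. i (s n)) \<xi> sequentially" for s \<xi>
  proof -
    obtain r l where r: "strict_mono (r::nat \<Rightarrow> nat)" "limitin Y ((\<lambda>n. j (s n)) \<circ> r) l sequentially"
      using cluster[of "\<lambda>n. j (s n)"] s(1) j by blast
    have "limitin X ((\<lambda>n. i (s n)) \<circ> r) \<xi> sequentially"
      using r(1) s(2) by (rule limitin_subsequence)
    then have "R \<xi> l"
      unfolding R_def using s(1) r(2) by (intro exI[of _ "s \<circ> r"]) (auto simp: o_def)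
    then show ?thesis using r by (auto simp: o_def)
  qed
  have R_total: "\<exists>l. R \<xi> l" if \<xi>: "\<xi> \<in> topspace X" for \<xi>
  proof -
    obtain B :: "nat \<Rightarrow> _" where B: "\<forall>n. openin X (B n) \<and> \<xi> \<in> B n" "decseq B"
      "\<forall>U. openin X U \<and> \<xi> \<in> U \<longrightarrow> (\<exists>n. B n \<subseteq> U)"
      by (rule first_countable_decreasing_base[OF X \<xi>])
    have "\<exists>x. x \<in> D \<and> i x \<in> B n" for n
      using dense \<xi> B(1) unfolding closure_of_def by blast
    then obtain s where s: "\<And>n. s n \<in> D" "\<And>n. i (s n) \<in> B n" by metis
    from s(2) have "limitin X (\<lambda>n. i (s n)) \<xi> sequentially"
      by (intro limitin_decreasing_base[OF B(2,3) \<xi>])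
    then show ?thesis using subseq[of s \<xi>] s(1) by blast
  qed
  define F where "F = (\<lambda>\<xi>. SOME l. R \<xi> l)"
  have RF: "R \<xi> (F \<xi>)" if "\<xi> \<in> topspace X" for \<xi>
    unfolding F_def using R_total[OF that] by (rule someI_ex)
  have F_eq: "F \<xi> = l" if "R \<xi> l" for \<xi> l
  proof -
    have "\<xi> \<in> topspace X" using that unfolding R_def limitin_def by blast
    then show ?thesis using RF R_unique that by blast
  qed
  have FY: "F \<xi> \<in> topspace Y" if "\<xi> \<in> topspace X" for \<xi>
    using RF[OF that] unfolding R_def limitin_def by blast
  have "openin X {\<xi> \<in> topspace X. F \<xi> \<in> U}" if U: "openin Y U" for U
  proof (subst openin_subopen, intro ballI)
    fix \<xi> assume "\<xi> \<in> {\<xi> \<in> topspace X. F \<xi> \<in> U}"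
    then have \<xi>: "\<xi> \<in> topspace X" "F \<xi> \<in> U" by auto
    obtain B :: "nat \<Rightarrow> _" where B: "\<forall>n. openin X (B n) \<and> \<xi> \<in> B n" "decseq B"
      "\<forall>U. openin X U \<and> \<xi> \<in> U \<longrightarrow> (\<exists>n. B n \<subseteq> U)"
      by (rule first_countable_decreasing_base[OF X \<xi>(1)])
    have BX: "B n \<subseteq> topspace X" for n using B(1) openin_subset by blast
    have "\<exists>n. B n \<subseteq> {\<xi> \<in> topspace X. F \<xi> \<in> U}"
    proof (rule ccontr)
      assume "\<not> (\<exists>n. B n \<subseteq> {\<xi> \<in> topspace X. F \<xi> \<in> U})"
      then have "\<forall>n. \<exists>\<eta>. \<eta> \<in> B n \<and> F \<eta> \<notin> U" using BX by blast
      then obtain \<eta> where \<eta>: "\<And>n. \<eta> n \<in> B n" "\<And>n. F (\<eta> n) \<notin> U" by metis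
      have \<eta>X: "\<eta> n \<in> topspace X" for n using \<eta>(1) BX by blast
      obtain r l where r: "strict_mono (r::nat \<Rightarrow> nat)" "limitin Y ((\<lambda>n. F (\<eta> n)) \<circ> r) l sequentially"
        using cluster[of "\<lambda>n. F (\<eta> n)"] FY[OF \<eta>X] by blast
      have "l \<notin> U"
      proof
        assume "l \<in> U"
        then have "eventually (\<lambda>n. F (\<eta> (r n)) \<in> U) sequentially"
          using r(2) U unfolding limitin_def by auto
        then show False using \<eta>(2) by simp
      qed
      then have ne: "l \<noteq> F \<xi>" using \<xi>(2) by blast
      have "l \<in> topspace Y" using r(2) by (simp add: limitin_def)
      then obtain P Q where PQ: "openin Y P" "openin Y Q" "l \<in> P" "F \<xi> \<in> Q" "P \<inter> Q = {}"
        using Y(1) ne FY[OF \<xi>(1)] unfolding Hausdorff_space_def disjnt_def by meson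
      have "eventually (\<lambda>n. F (\<eta> (r n)) \<in> P) sequentially"
        using r(2) PQ unfolding limitin_def by auto
      then obtain N where N: "\<And>n. n \<ge> N \<Longrightarrow> F (\<eta> (r n)) \<in> P"
        by (auto simp: eventually_sequentially)
      have "\<exists>x. x \<in> D \<and> i x \<in> B n \<and> j x \<in> P" for n
      proof -
        define m where "m = max n N"
        have "\<eta> (r m) \<in> B (r m)" using \<eta>(1) .
        moreover have "R (\<eta> (r m)) (F (\<eta> (r m)))" using RF \<eta>X by blast
        then obtain s :: "nat \<Rightarrow> 'd" where s: "range s \<subseteq> D" "limitin X (\<lambda>n. i (s n)) (\<eta> (r m)) sequentially"
          "limitin Y (\<lambda>n. j (s n)) (F (\<eta> (r m))) sequentially"
          unfolding R_def by blast
        moreover have "F (\<eta> (r m)) \<in> P" using N by (simp add: m_def)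
        ultimately obtain k where "i (s k) \<in> B (r m)" "j (s k) \<in> P"
          using limitin_common_index[of X _ _ "B (r m)" Y _ _ P] B(1) PQ(1) by blast
        moreover have "n \<le> r m" using seq_suble[OF r(1), of m] by (simp add: m_def)
        then have "B (r m) \<subseteq> B n" using decseqD[OF B(2)] by blast
        ultimately show ?thesis using s(1) by blast
      qed
      then obtain s where s: "\<And>n. s n \<in> D" "\<And>n. i (s n) \<in> B n" "\<And>n. j (s n) \<in> P" by metis
      have "limitin X (\<lambda>n. i (s n)) \<xi> sequentially"
        by (intro limitin_decreasing_base[OF B(2,3) \<xi>(1)] s(2))
      then obtain q l' where q: "limitin Y (\<lambda>n. j (s (q n))) l' sequentially" "R \<xi> l'"
        using subseq[of s \<xi>] s(1) by blast
      then have "l' = F \<xi>" using F_eq by blast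
      then have "eventually (\<lambda>n. j (s (q n)) \<in> Q) sequentially"
        using q(1) PQ(2,4) unfolding limitin_def by blast
      then have "\<exists>n. j (s (q n)) \<in> Q" by (auto simp: eventually_sequentially)
      then show False using s(3) PQ(5) by blast
    qed
    then show "\<exists>T. openin X T \<and> \<xi> \<in> T \<and> T \<subseteq> {\<xi> \<in> topspace X. F \<xi> \<in> U}"
      using B(1) by blast
  qed
  then have "continuous_map X Y F"
    unfolding continuous_map_def using FY by blast
  moreover have "F \<xi> = l"
    if "range s \<subseteq> D" "limitin X (\<lambda>n. i (s n)) \<xi> sequentially" "limitin Y (\<lambda>n. j (s n)) l sequentially"
    for s \<xi> l
    using that F_eq unfolding R_def by blast
  ultimately show ?thesis by (intro that[of F]) auto
qed

section \<open>Functions modulo constants\<close>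

text \<open>
  By the Lindelof property countably many of the open sets \<open>V\<close> suffice to cover \<open>\<Omega>\<close>.
\<close>

lemma sigma_compact_exhaustion:
  fixes \<Omega> :: "'a::second_countable_topology set"
  assumes "\<And>x. x \<in> \<Omega> \<Longrightarrow> \<exists>V C. open V \<and> compact C \<and> x \<in> V \<and> V \<subseteq> C \<and> C \<subseteq> \<Omega>"
  obtains L :: "nat \<Rightarrow> 'a set" where "\<forall>n. compact (L n) \<and> L n \<subseteq> \<Omega>"
    "\<forall>C. compact C \<and> C \<subseteq> \<Omega> \<longrightarrow> (\<exists>n. C \<subseteq> L n)"
proof -
  define \<F> where "\<F> = insert {} {V. open V \<and> (\<exists>C. compact C \<and> V \<subseteq> C \<and> C \<subseteq> \<Omega>)}"
  have "open V" if "V \<in> \<F>" for V using that unfolding \<F>_def by auto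
  then obtain \<F>' where \<F>': "\<F>' \<subseteq> \<F>" "countable \<F>'" "\<Union>\<F>' = \<Union>\<F>" by (rule Lindelof)
  define \<G> where "\<G> = insert {} \<F>'"
  have "range (from_nat_into \<G>) = \<G>"
    by (rule range_from_nat_into) (use \<F>'(2) in \<open>auto simp: \<G>_def\<close>)
  then obtain V :: "nat \<Rightarrow> _" where V: "range V = \<G>" by blast
  have "{} \<in> \<F>" by (simp add: \<F>_def)
  then have "\<G> \<subseteq> \<F>" using \<F>'(1) by (simp add: \<G>_def)
  then have V\<F>: "V n \<in> \<F>" for n using V by blast
  have "\<exists>C. compact C \<and> V n \<subseteq> C \<and> C \<subseteq> \<Omega>" for n
  proof -
    consider "V n = {}" | "\<exists>C. compact C \<and> V n \<subseteq> C \<and> C \<subseteq> \<Omega>"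
      using V\<F>[of n] unfolding \<F>_def by auto
    then show ?thesis
    proof cases
      case 1
      then show ?thesis by (intro exI[of _ "{}"]) simp
    qed
  qed
  then obtain c where c: "\<And>n. compact (c n)" "\<And>n. V n \<subseteq> c n" "\<And>n. c n \<subseteq> \<Omega>" by metis
  define L where "L = (\<lambda>n. \<Union>i\<le>n. c i)"
  have "compact (L n) \<and> L n \<subseteq> \<Omega>" for n
  proof
    show "compact (L n)" unfolding L_def using c(1) by (intro compact_UN) auto
    show "L n \<subseteq> \<Omega>" unfolding L_def using c(3) by blast
  qed
  moreover have "\<exists>n. C \<subseteq> L n" if C: "compact C" "C \<subseteq> \<Omega>" for C
  proof -
    have "\<Omega> \<subseteq> \<Union>\<F>"
    proof
      fix x assume "x \<in> \<Omega>"
      then obtain V C where "open V" "compact C" "x \<in> V" "V \<subseteq> C" "C \<subseteq> \<Omega>" using assms by meson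
      then have "V \<in> \<F>" unfolding \<F>_def by blast
      then show "x \<in> \<Union>\<F>" using \<open>x \<in> V\<close> by blast
    qed
    then have "C \<subseteq> \<Union>\<F>'" using C(2) \<F>'(3) by simp
    then have "C \<subseteq> \<Union>(range V)" unfolding V \<G>_def by simp
    moreover have "open (V n)" for n
      using V\<F>[of n] unfolding \<F>_def by auto
    ultimately obtain I where I: "finite I" "C \<subseteq> (\<Union>i\<in>I. V i)"
      using compactE_image[OF C(1), of UNIV V] by auto
    have "(\<Union>i\<in>I. V i) \<subseteq> L (Max (insert 0 I))"
      unfolding L_def using I(1) c(2) by (intro UN_mono) auto
    then have "C \<subseteq> L (Max (insert 0 I))" using I(2) by (rule order_trans[rotated])
    then show ?thesis ..
  qed
  ultimately show ?thesis by (intro that[of L]) auto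
qed

lemma mod_const_class_eq_iff:
  assumes "f \<in> cont_funs \<Omega>" "g \<in> cont_funs \<Omega>"
  shows "mod_const_rel \<Omega> `` {f} = mod_const_rel \<Omega> `` {g} \<longleftrightarrow> (\<exists>c. \<forall>x\<in>\<Omega>. g x = f x + c)"
  using eq_equiv_class_iff[OF equiv_mod_const_rel assms] assms by (simp add: mod_const_rel_def)

lemma topspace_cont_funs_mod_const_top:
  "topspace (cont_funs_mod_const_top \<Omega>) = cont_funs \<Omega> // mod_const_rel \<Omega>"
proof
  show "topspace (cont_funs_mod_const_top \<Omega>) \<subseteq> cont_funs \<Omega> // mod_const_rel \<Omega>"
    using openin_topspace[of "cont_funs_mod_const_top \<Omega>"] unfolding openin_cont_funs_mod_const_top by blast
  have "cont_funs_open \<Omega> (cont_funs \<Omega>)"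
    unfolding cont_funs_open_def
  proof (intro conjI ballI subset_refl)
    show "\<exists>K \<epsilon>. compact K \<and> K \<subseteq> \<Omega> \<and> 0 < \<epsilon> \<and>
              {g \<in> cont_funs \<Omega>. \<forall>x\<in>K. \<bar>g x - f x\<bar> < \<epsilon>} \<subseteq> cont_funs \<Omega>" for f
      by (intro exI[of _ "{}"] exI[of _ "1::real"]) auto
  qed
  then have "openin (cont_funs_mod_const_top \<Omega>) (cont_funs \<Omega> // mod_const_rel \<Omega>)"
    unfolding openin_cont_funs_mod_const_top openin_cont_funs_top
    by (simp add: Union_quotient[OF equiv_mod_const_rel])
  then show "cont_funs \<Omega> // mod_const_rel \<Omega> \<subseteq> topspace (cont_funs_mod_const_top \<Omega>)"
    by (rule openin_subset)
qed

lemma mod_const_class_in_topspace: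
  "f \<in> cont_funs \<Omega> \<Longrightarrow> mod_const_rel \<Omega> `` {f} \<in> topspace (cont_funs_mod_const_top \<Omega>)"
  unfolding topspace_cont_funs_mod_const_top by (rule quotientI)

text \<open>
  Functions modulo constants are compared after normalisation at a base point \<open>p\<close>. This identifies the
  quotient with the functions that vanish at \<open>p\<close>.
\<close>

definition class_nbhd ::
  "'a::topological_space set \<Rightarrow> 'a \<Rightarrow> ('a \<Rightarrow> real) \<Rightarrow> 'a set \<Rightarrow> real \<Rightarrow> ('a \<Rightarrow> real) set set" where
  "class_nbhd \<Omega> p f C e = (\<lambda>g. mod_const_rel \<Omega> `` {g}) `
     {g \<in> cont_funs \<Omega>. \<forall>z\<in>C. \<bar>(g z - g p) - (f z - f p)\<bar> < e}"

lemma class_in_class_nbhd_iff: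
  assumes "p \<in> \<Omega>" "C \<subseteq> \<Omega>" "g \<in> cont_funs \<Omega>"
  shows "mod_const_rel \<Omega> `` {g} \<in> class_nbhd \<Omega> p f C e \<longleftrightarrow>
     (\<forall>z\<in>C. \<bar>(g z - g p) - (f z - f p)\<bar> < e)"
proof
  assume "mod_const_rel \<Omega> `` {g} \<in> class_nbhd \<Omega> p f C e"
  then obtain h where h: "h \<in> cont_funs \<Omega>" "mod_const_rel \<Omega> `` {g} = mod_const_rel \<Omega> `` {h}"
    "\<forall>z\<in>C. \<bar>(h z - h p) - (f z - f p)\<bar> < e" unfolding class_nbhd_def by blast
  then obtain c where "\<forall>x\<in>\<Omega>. h x = g x + c"
    using mod_const_class_eq_iff[OF assms(3) h(1)] by blast
  then show "\<forall>z\<in>C. \<bar>(g z - g p) - (f z - f p)\<bar> < e"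
    using h(3) assms(1,2) by (auto simp: subset_iff)
qed (use assms in \<open>auto simp: class_nbhd_def\<close>)

lemma openin_class_nbhd:
  assumes p: "p \<in> \<Omega>" and C: "compact C" "C \<subseteq> \<Omega>" and f: "f \<in> cont_funs \<Omega>"
  shows "openin (cont_funs_mod_const_top \<Omega>) (class_nbhd \<Omega> p f C e)"
  unfolding openin_cont_funs_mod_const_top openin_cont_funs_top
proof
  show "class_nbhd \<Omega> p f C e \<subseteq> cont_funs \<Omega> // mod_const_rel \<Omega>"
    unfolding class_nbhd_def by (auto intro: quotientI)
  have eq: "\<Union>(class_nbhd \<Omega> p f C e) = {g \<in> cont_funs \<Omega>. \<forall>z\<in>C. \<bar>(g z - g p) - (f z - f p)\<bar> < e}"
    (is "_ = ?N")
  proof (intro equalityI subsetI)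
    fix g assume "g \<in> \<Union>(class_nbhd \<Omega> p f C e)"
    then obtain h where h: "h \<in> cont_funs \<Omega>" "(h, g) \<in> mod_const_rel \<Omega>"
      "\<forall>z\<in>C. \<bar>(h z - h p) - (f z - f p)\<bar> < e" unfolding class_nbhd_def by blast
    then obtain c where "g \<in> cont_funs \<Omega>" "\<forall>x\<in>\<Omega>. g x = h x + c"
      unfolding mod_const_rel_def by blast
    then show "g \<in> ?N" using h(3) p C(2) by (auto simp: subset_iff)
  next
    fix g assume g: "g \<in> ?N"
    then have "mod_const_rel \<Omega> `` {g} \<in> class_nbhd \<Omega> p f C e"
      unfolding class_nbhd_def by blast
    moreover have "g \<in> mod_const_rel \<Omega> `` {g}"
      using g equiv_class_self[OF equiv_mod_const_rel] by blast
    ultimately show "g \<in> \<Union>(class_nbhd \<Omega> p f C e)" by blast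
  qed
  show "cont_funs_open \<Omega> (\<Union>(class_nbhd \<Omega> p f C e))"
    unfolding eq cont_funs_open_def
  proof (intro conjI ballI)
    fix g assume g: "g \<in> ?N"
    \<comment> \<open>By compactness the strict inequality holds with a margin, which is shared between the
      perturbations of \<open>g\<close> at \<open>z\<close> and at the base point.\<close>
    define u where "u = (\<lambda>z. \<bar>(g z - g p) - (f z - f p)\<bar>)"
    have "\<exists>m<e. \<forall>z\<in>C. u z \<le> m"
    proof (cases "C = {}")
      case True
      then show ?thesis by (intro exI[of _ "e - 1"]) simp
    next
      case False
      have "continuous_on C u"
        unfolding u_def using f g C(2)
        by (intro continuous_intros) (auto simp: cont_funs_def intro: continuous_on_subset)
      then obtain z0 where "z0 \<in> C" "\<forall>z\<in>C. u z \<le> u z0"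
        using continuous_attains_sup[OF C(1) False] by blast
      then show ?thesis using g by (intro exI[of _ "u z0"]) (auto simp: u_def)
    qed
    then obtain m where m: "m < e" "\<And>z. z \<in> C \<Longrightarrow> u z \<le> m" by blast
    have "\<bar>(h z - h p) - (f z - f p)\<bar> < e"
      if h: "\<forall>x\<in>insert p C. \<bar>h x - g x\<bar> < (e - m) / 2" and z: "z \<in> C" for h z
    proof -
      have "\<bar>h z - g z\<bar> < (e - m) / 2" "\<bar>h p - g p\<bar> < (e - m) / 2" using h z by auto
      moreover have "\<bar>(g z - g p) - (f z - f p)\<bar> \<le> m" using m(2)[OF z] by (simp add: u_def)
      ultimately show ?thesis by argo
    qed
    then show "\<exists>L \<epsilon>. compact L \<and> L \<subseteq> \<Omega> \<and> \<epsilon> > 0 \<and> {h \<in> cont_funs \<Omega>. \<forall>x\<in>L. \<bar>h x - g x\<bar> < \<epsilon>} \<subseteq> ?N"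
      using m(1) C p by (intro exI[of _ "insert p C"] exI[of _ "(e - m) / 2"]) auto
  qed blast
qed

lemma class_nbhd_base:
  assumes p: "p \<in> \<Omega>" and f: "f \<in> cont_funs \<Omega>"
    and U: "openin (cont_funs_mod_const_top \<Omega>) U" "mod_const_rel \<Omega> `` {f} \<in> U"
  obtains C e where "compact C" "C \<subseteq> \<Omega>" "e > 0" "class_nbhd \<Omega> p f C e \<subseteq> U"
proof -
  have "f \<in> \<Union>U" using U(2) equiv_class_self[OF equiv_mod_const_rel f] by blast
  then obtain C e where C: "compact C" "C \<subseteq> \<Omega>" "e > 0"
    and sub: "{g \<in> cont_funs \<Omega>. \<forall>x\<in>C. \<bar>g x - f x\<bar> < e} \<subseteq> \<Union>U"
    using U(1) unfolding openin_cont_funs_mod_const_top openin_cont_funs_top cont_funs_open_def by meson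
  have Uq: "U \<subseteq> cont_funs \<Omega> // mod_const_rel \<Omega>"
    using U(1) unfolding openin_cont_funs_mod_const_top by blast
  have "mod_const_rel \<Omega> `` {g} \<in> U"
    if g: "g \<in> cont_funs \<Omega>" "\<forall>z\<in>C. \<bar>(g z - g p) - (f z - f p)\<bar> < e" for g
  proof -
    \<comment> \<open>The representative of the class of \<open>g\<close> that agrees with \<open>f\<close> at \<open>p\<close>.\<close>
    define h where "h = restrict (\<lambda>z. g z - (g p - f p)) \<Omega>"
    have h: "h \<in> cont_funs \<Omega>"
    proof -
      have "continuous_on \<Omega> (\<lambda>z. g z - (g p - f p))"
        using g(1) unfolding cont_funs_def by (auto intro!: continuous_intros)
      then have "continuous_on \<Omega> h"
        by (rule continuous_on_eq) (simp add: h_def)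
      then show ?thesis by (simp add: cont_funs_def h_def)
    qed
    have hz: "h z = g z - (g p - f p)" if "z \<in> \<Omega>" for z using that by (simp add: h_def)
    have "\<forall>z\<in>C. \<bar>h z - f z\<bar> < e"
    proof
      fix z assume z: "z \<in> C"
      then have "\<bar>(g z - g p) - (f z - f p)\<bar> < e" using g(2) by blast
      moreover have "h z = g z - (g p - f p)" using hz C(2) z by blast
      ultimately show "\<bar>h z - f z\<bar> < e" by argo
    qed
    then have "h \<in> \<Union>U" using sub h by blast
    then obtain V where V: "V \<in> U" "h \<in> V" by blast
    have "\<forall>z\<in>\<Omega>. h z = g z + (f p - g p)" using hz by simp
    then have "mod_const_rel \<Omega> `` {g} = mod_const_rel \<Omega> `` {h}"
      using mod_const_class_eq_iff[OF g(1) h] by blast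
    moreover have "V = mod_const_rel \<Omega> `` {h}"
    proof -
      obtain k where k: "V = mod_const_rel \<Omega> `` {k}" using V(1) Uq by (blast elim: quotientE)
      then have "(k, h) \<in> mod_const_rel \<Omega>" using V(2) by simp
      then show ?thesis using k equiv_class_eq[OF equiv_mod_const_rel] by blast
    qed
    ultimately show ?thesis using V(1) by simp
  qed
  then have "class_nbhd \<Omega> p f C e \<subseteq> U" unfolding class_nbhd_def by blast
  then show ?thesis using that C by blast
qed

lemma limitin_mod_const_iff:
  assumes p: "p \<in> \<Omega>" and f: "\<And>n. f n \<in> cont_funs \<Omega>" and g: "g \<in> cont_funs \<Omega>"
  shows "limitin (cont_funs_mod_const_top \<Omega>) (\<lambda>n. mod_const_rel \<Omega> `` {f n}) (mod_const_rel \<Omega> `` {g}) F \<longleftrightarrow>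
    (\<forall>C e. compact C \<and> C \<subseteq> \<Omega> \<and> e > 0 \<longrightarrow>
       eventually (\<lambda>n. \<forall>z\<in>C. \<bar>(f n z - f n p) - (g z - g p)\<bar> < e) F)" (is "?L \<longleftrightarrow> ?R")
proof
  assume L: ?L
  show ?R
  proof (intro allI impI)
    fix C and e :: real assume C: "compact C \<and> C \<subseteq> \<Omega> \<and> e > 0"
    have "mod_const_rel \<Omega> `` {g} \<in> class_nbhd \<Omega> p g C e"
      using C class_in_class_nbhd_iff[OF p _ g] by simp
    then have "eventually (\<lambda>n. mod_const_rel \<Omega> `` {f n} \<in> class_nbhd \<Omega> p g C e) F"
      using L openin_class_nbhd[OF p _ _ g, of C e] C unfolding limitin_def by blast
    then show "eventually (\<lambda>n. \<forall>z\<in>C. \<bar>(f n z - f n p) - (g z - g p)\<bar> < e) F"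
      using class_in_class_nbhd_iff[OF p _ f] C by simp
  qed
next
  assume R: ?R
  show ?L
    unfolding limitin_def
  proof (intro conjI allI impI)
    show "mod_const_rel \<Omega> `` {g} \<in> topspace (cont_funs_mod_const_top \<Omega>)"
      using g by (rule mod_const_class_in_topspace)
    fix U assume U: "openin (cont_funs_mod_const_top \<Omega>) U \<and> mod_const_rel \<Omega> `` {g} \<in> U"
    obtain C e where C: "compact C" "C \<subseteq> \<Omega>" "e > 0" "class_nbhd \<Omega> p g C e \<subseteq> U"
      by (rule class_nbhd_base[OF p g conjunct1[OF U] conjunct2[OF U]])
    then have "eventually (\<lambda>n. \<forall>z\<in>C. \<bar>(f n z - f n p) - (g z - g p)\<bar> < e) F" using R by blast
    then show "eventually (\<lambda>n. mod_const_rel \<Omega> `` {f n} \<in> U) F"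
      by (rule eventually_mono) (use C class_in_class_nbhd_iff[OF p C(2) f] in blast)
  qed
qed

lemma first_countable_cont_funs_mod_const_top:
  fixes \<Omega> :: "'a::second_countable_topology set"
  assumes p: "p \<in> \<Omega>"
    and "\<And>x. x \<in> \<Omega> \<Longrightarrow> \<exists>V C. open V \<and> compact C \<and> x \<in> V \<and> V \<subseteq> C \<and> C \<subseteq> \<Omega>"
  shows "first_countable (cont_funs_mod_const_top \<Omega>)"
  unfolding first_countable_def
proof
  obtain L :: "nat \<Rightarrow> 'a set" where L: "\<forall>n. compact (L n) \<and> L n \<subseteq> \<Omega>"
    "\<forall>C. compact C \<and> C \<subseteq> \<Omega> \<longrightarrow> (\<exists>n. C \<subseteq> L n)"
    by (rule sigma_compact_exhaustion[OF assms(2)])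
  fix \<xi> assume "\<xi> \<in> topspace (cont_funs_mod_const_top \<Omega>)"
  then obtain f where f: "f \<in> cont_funs \<Omega>" "\<xi> = mod_const_rel \<Omega> `` {f}"
    unfolding topspace_cont_funs_mod_const_top by (blast elim: quotientE)
  define \<B> where "\<B> = (\<lambda>(n, m). class_nbhd \<Omega> p f (L n) (inverse (real (Suc m)))) ` UNIV"
  have "countable \<B>" unfolding \<B>_def by simp
  moreover have "\<forall>V\<in>\<B>. openin (cont_funs_mod_const_top \<Omega>) V"
    unfolding \<B>_def using openin_class_nbhd[OF p _ _ f(1)] L(1) by auto
  moreover have "\<exists>V\<in>\<B>. \<xi> \<in> V \<and> V \<subseteq> U"
    if U: "openin (cont_funs_mod_const_top \<Omega>) U \<and> \<xi> \<in> U" for U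
  proof -
    have U': "openin (cont_funs_mod_const_top \<Omega>) U" "mod_const_rel \<Omega> `` {f} \<in> U"
      using U f(2) by auto
    obtain C e where C: "compact C" "C \<subseteq> \<Omega>" "e > 0" "class_nbhd \<Omega> p f C e \<subseteq> U"
      by (rule class_nbhd_base[OF p f(1) U'])
    obtain n where n: "C \<subseteq> L n" using L(2) C by blast
    obtain m where m: "inverse (real (Suc m)) < e" using reals_Archimedean[OF C(3)] by blast
    have "\<forall>z\<in>C. \<bar>(g z - g p) - (f z - f p)\<bar> < e"
      if "\<forall>z\<in>L n. \<bar>(g z - g p) - (f z - f p)\<bar> < inverse (real (Suc m))" for g
      using that n m by (meson subsetD less_trans)
    then have "class_nbhd \<Omega> p f (L n) (inverse (real (Suc m))) \<subseteq> class_nbhd \<Omega> p f C e"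
      unfolding class_nbhd_def by (intro image_mono) blast
    moreover have "\<xi> \<in> class_nbhd \<Omega> p f (L n) (inverse (real (Suc m)))"
      unfolding f(2) using class_in_class_nbhd_iff[OF p _ f(1), of "L n"] L(1) by simp
    moreover have "class_nbhd \<Omega> p f (L n) (inverse (real (Suc m))) \<in> \<B>"
      unfolding \<B>_def by (rule image_eqI[of _ _ "(n, m)"]) auto
    ultimately show ?thesis using C(4) by blast
  qed
  ultimately show "\<exists>\<B>. countable \<B> \<and> (\<forall>V\<in>\<B>. openin (cont_funs_mod_const_top \<Omega>) V) \<and>
      (\<forall>U. openin (cont_funs_mod_const_top \<Omega>) U \<and> \<xi> \<in> U \<longrightarrow> (\<exists>V\<in>\<B>. \<xi> \<in> V \<and> V \<subseteq> U))" by blast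
qed

lemma Hausdorff_cont_funs_mod_const_top:
  assumes p: "p \<in> \<Omega>"
  shows "Hausdorff_space (cont_funs_mod_const_top \<Omega>)"
  unfolding Hausdorff_space_def
proof (intro allI impI, elim conjE)
  fix \<xi> \<eta> assume "\<xi> \<in> topspace (cont_funs_mod_const_top \<Omega>)" "\<eta> \<in> topspace (cont_funs_mod_const_top \<Omega>)"
    and ne: "\<xi> \<noteq> \<eta>"
  then obtain f g where f: "f \<in> cont_funs \<Omega>" "\<xi> = mod_const_rel \<Omega> `` {f}"
    and g: "g \<in> cont_funs \<Omega>" "\<eta> = mod_const_rel \<Omega> `` {g}"
    unfolding topspace_cont_funs_mod_const_top by (blast elim: quotientE)
  have "\<exists>z\<in>\<Omega>. g z \<noteq> f z + (g p - f p)"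
    using ne mod_const_class_eq_iff[OF f(1) g(1)] f(2) g(2) by blast
  then obtain z where z: "z \<in> \<Omega>" "g z \<noteq> f z + (g p - f p)" by blast
  define e where "e = \<bar>(g z - g p) - (f z - f p)\<bar> / 2"
  have e: "e > 0" using z(2) unfolding e_def by auto
  let ?U = "class_nbhd \<Omega> p f {z} e" and ?V = "class_nbhd \<Omega> p g {z} e"
  have "disjnt ?U ?V"
    unfolding disjnt_def
  proof (rule equals0I)
    fix \<zeta> assume \<zeta>: "\<zeta> \<in> ?U \<inter> ?V"
    then obtain h where h: "h \<in> cont_funs \<Omega>" "\<zeta> = mod_const_rel \<Omega> `` {h}"
      unfolding class_nbhd_def by blast
    then have "\<bar>(h z - h p) - (f z - f p)\<bar> < e" "\<bar>(h z - h p) - (g z - g p)\<bar> < e"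
      using \<zeta> class_in_class_nbhd_iff[OF p _ h(1), of "{z}"] z(1) by auto
    then show False unfolding e_def by argo
  qed
  moreover have "openin (cont_funs_mod_const_top \<Omega>) ?U" "openin (cont_funs_mod_const_top \<Omega>) ?V"
    using z(1) by (auto intro!: openin_class_nbhd p f g)
  moreover have "\<xi> \<in> ?U" "\<eta> \<in> ?V"
    unfolding f(2) g(2) using class_in_class_nbhd_iff[OF p _ f(1)] class_in_class_nbhd_iff[OF p _ g(1)] z(1) e
    by auto
  ultimately show "\<exists>U V. openin (cont_funs_mod_const_top \<Omega>) U \<and> openin (cont_funs_mod_const_top \<Omega>) V \<and>
      \<xi> \<in> U \<and> \<eta> \<in> V \<and> disjnt U V" by blast
qed

section \<open>The metric compactification\<close>

text \<open>
  Besides local compactness of the domain, two properties of the Kobayashi distance matter: it is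
  continuous with respect to the manifold topology, and almost shortest connections cross frontiers,
  which is a weak form of being a length distance.
\<close>

locale crossing_metric_domain = Metric_space \<Omega> d
  for \<Omega> :: "'a::{t2_space, second_countable_topology} set" and d :: "'a \<Rightarrow> 'a \<Rightarrow> real" +
  assumes small_near: "\<And>x e. x \<in> \<Omega> \<Longrightarrow> e > 0 \<Longrightarrow> \<exists>V. open V \<and> x \<in> V \<and> V \<subseteq> \<Omega> \<and> (\<forall>y\<in>V. d x y < e)"
    and open_domain: "open \<Omega>"
    and locally_compact: "\<And>x U. open U \<Longrightarrow> x \<in> U \<Longrightarrow> U \<subseteq> \<Omega> \<Longrightarrow>
       \<exists>V C. open V \<and> compact C \<and> x \<in> V \<and> V \<subseteq> C \<and> C \<subseteq> U"
    and crosses_frontier: "\<And>x y C e. \<lbrakk>x \<in> \<Omega>; y \<in> \<Omega>; x \<in> C; y \<notin> C; e > 0\<rbrakk> \<Longrightarrow>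
       \<exists>z\<in>frontier C. z \<in> \<Omega> \<and> d x z + d z y < d x y + e"
begin

abbreviation embed :: "'a \<Rightarrow> ('a \<Rightarrow> real) set" where
  "embed \<equiv> metric_embed \<Omega> d"

lemma dist_diff_le: "x \<in> \<Omega> \<Longrightarrow> y \<in> \<Omega> \<Longrightarrow> z \<in> \<Omega> \<Longrightarrow> \<bar>d x z - d y z\<bar> \<le> d x y"
  using triangle[of x y z] triangle[of y x z] commute[of x y] by linarith

lemma dist_diff_le': "x \<in> \<Omega> \<Longrightarrow> y \<in> \<Omega> \<Longrightarrow> z \<in> \<Omega> \<Longrightarrow> \<bar>d x y - d x z\<bar> \<le> d y z"
  using dist_diff_le[of y z x] commute[of x y] commute[of x z] by simp

lemma continuous_on_if_Lipschitz:
  fixes f :: "'a \<Rightarrow> real"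
  assumes f: "\<And>x y. x \<in> \<Omega> \<Longrightarrow> y \<in> \<Omega> \<Longrightarrow> \<bar>f x - f y\<bar> \<le> d x y"
  shows "continuous_on \<Omega> f"
  unfolding continuous_on_def
proof (intro ballI tendstoI)
  fix x and e :: real assume x: "x \<in> \<Omega>" and e: "e > 0"
  obtain V where V: "open V" "x \<in> V" "V \<subseteq> \<Omega>" "\<forall>y\<in>V. d x y < e"
    using small_near[OF x e] by blast
  have "dist (f y) (f x) < e" if "y \<in> V" for y
    using V(3,4) that f[OF x, of y] by (force simp: dist_real_def abs_minus_commute)
  then show "eventually (\<lambda>y. dist (f y) (f x) < e) (at x within \<Omega>)"
    unfolding eventually_at_topological using V(1,2) by blast
qed

lemma continuous_on_dist: "x \<in> \<Omega> \<Longrightarrow> continuous_on \<Omega> (d x)"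
  using dist_diff_le' by (intro continuous_on_if_Lipschitz)

lemma restrict_dist_in_cont_funs:
  assumes "x \<in> \<Omega>"
  shows "restrict (d x) \<Omega> \<in> cont_funs \<Omega>"
proof -
  have "continuous_on \<Omega> (restrict (d x) \<Omega>)"
    using continuous_on_dist[OF assms] by (rule continuous_on_eq) simp
  then show ?thesis by (simp add: cont_funs_def)
qed

lemma topspace_metric_compactification:
  "topspace (metric_compactification \<Omega> d) = cont_funs_mod_const_top \<Omega> closure_of (embed ` \<Omega>)"
  unfolding metric_compactification_def by (simp add: closure_of_subset_topspace inf.absorb2)

lemma embed_subset_closure: "embed ` \<Omega> \<subseteq> cont_funs_mod_const_top \<Omega> closure_of (embed ` \<Omega>)"
  unfolding metric_embed_def
  by (intro closure_of_subset) (auto intro!: mod_const_class_in_topspace restrict_dist_in_cont_funs)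

lemma embed_dense:
  "topspace (metric_compactification \<Omega> d) \<subseteq> metric_compactification \<Omega> d closure_of (embed ` \<Omega>)"
  unfolding topspace_metric_compactification
  unfolding metric_compactification_def
  using embed_subset_closure by (simp add: closure_of_subtopology_subset closure_of_subtopology inf.absorb2)

lemma first_countable_metric_compactification:
  "p \<in> \<Omega> \<Longrightarrow> first_countable (metric_compactification \<Omega> d)"
  unfolding metric_compactification_def
  by (intro first_countable_subtopology first_countable_cont_funs_mod_const_top[of p]
      locally_compact[OF open_domain]) auto

lemma Hausdorff_metric_compactification:
  "p \<in> \<Omega> \<Longrightarrow> Hausdorff_space (metric_compactification \<Omega> d)"
  unfolding metric_compactification_def
  by (intro Hausdorff_space_subtopology Hausdorff_cont_funs_mod_const_top)

lemma limitin_class_iff: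
  assumes p: "p \<in> \<Omega>" and s: "\<And>n. s n \<in> \<Omega>" and g: "g \<in> cont_funs \<Omega>"
  shows "limitin (metric_compactification \<Omega> d) (\<lambda>n::nat. embed (s n)) (mod_const_rel \<Omega> `` {g}) sequentially \<longleftrightarrow>
    (\<forall>C e. compact C \<and> C \<subseteq> \<Omega> \<and> e > 0 \<longrightarrow>
       eventually (\<lambda>n. \<forall>z\<in>C. \<bar>(d (s n) z - d (s n) p) - (g z - g p)\<bar> < e) sequentially)" (is "?L \<longleftrightarrow> ?R")
proof -
  have "?L \<longleftrightarrow> limitin (cont_funs_mod_const_top \<Omega>) (\<lambda>n. embed (s n)) (mod_const_rel \<Omega> `` {g}) sequentially"
    (is "_ \<longleftrightarrow> ?L'")
  proof
    assume L: ?L'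
    have ev: "eventually (\<lambda>n. embed (s n) \<in> cont_funs_mod_const_top \<Omega> closure_of (embed ` \<Omega>)) sequentially"
      using embed_subset_closure s by (intro always_eventually allI) blast
    have "mod_const_rel \<Omega> `` {g} \<in> cont_funs_mod_const_top \<Omega> closure_of (embed ` \<Omega>)"
      using L ev by (intro limitin_closedin[OF L closedin_closure_of]) auto
    then show ?L unfolding metric_compactification_def limitin_subtopology using L ev by blast
  qed (simp add: metric_compactification_def limitin_subtopology)
  also have "\<dots> \<longleftrightarrow> (\<forall>C e. compact C \<and> C \<subseteq> \<Omega> \<and> e > 0 \<longrightarrow> eventually (\<lambda>n. \<forall>z\<in>C.
      \<bar>(restrict (d (s n)) \<Omega> z - restrict (d (s n)) \<Omega> p) - (g z - g p)\<bar> < e) sequentially)"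
    unfolding metric_embed_def using s by (intro limitin_mod_const_iff p g restrict_dist_in_cont_funs)
  also have "\<dots> \<longleftrightarrow> ?R"
    using p by (auto simp: subset_iff elim!: eventually_mono)
  finally show ?thesis .
qed

lemma limitin_embed_iff:
  assumes p: "p \<in> \<Omega>" and s: "\<And>n. s n \<in> \<Omega>" and x: "x \<in> \<Omega>"
  shows "limitin (metric_compactification \<Omega> d) (\<lambda>n::nat. embed (s n)) (embed x) sequentially \<longleftrightarrow>
    (\<forall>C e. compact C \<and> C \<subseteq> \<Omega> \<and> e > 0 \<longrightarrow>
       eventually (\<lambda>n. \<forall>z\<in>C. \<bar>(d (s n) z - d (s n) p) - (d x z - d x p)\<bar> < e) sequentially)"
  unfolding metric_embed_def[of \<Omega> d x] limitin_class_iff[OF p s restrict_dist_in_cont_funs[OF x]]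
  using p by (auto simp: subset_iff elim!: eventually_mono)

lemma embed_continuous:
  assumes s: "\<And>n. s n \<in> \<Omega>" and x: "x \<in> \<Omega>" and lim: "s \<longlonglongrightarrow> x"
  shows "limitin (metric_compactification \<Omega> d) (\<lambda>n::nat. embed (s n)) (embed x) sequentially"
  unfolding limitin_embed_iff[OF x s x]
proof (intro allI impI)
  fix C and e :: real assume C: "compact C \<and> C \<subseteq> \<Omega> \<and> e > 0"
  then have "e / 2 > 0" by simp
  then obtain V where V: "open V" "x \<in> V" "V \<subseteq> \<Omega>" "\<forall>y\<in>V. d x y < e / 2"
    using small_near[OF x] by meson
  \<comment> \<open>With \<open>x\<close> itself as base point, normalisation costs another \<open>d (s n) x\<close>.\<close>
  have "eventually (\<lambda>n. s n \<in> V) sequentially" using lim V(1,2) by (rule topological_tendstoD)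
  then show "eventually (\<lambda>n. \<forall>z\<in>C. \<bar>(d (s n) z - d (s n) x) - (d x z - d x x)\<bar> < e) sequentially"
  proof (rule eventually_mono)
    fix n assume n: "s n \<in> V"
    show "\<forall>z\<in>C. \<bar>(d (s n) z - d (s n) x) - (d x z - d x x)\<bar> < e"
    proof
      fix z assume "z \<in> C"
      then have "\<bar>d (s n) z - d x z\<bar> \<le> d (s n) x"
        using C s x by (intro dist_diff_le) auto
      moreover have "d (s n) x < e / 2" using V(4) n commute by metis
      moreover have "d x x = 0" using x by (simp add: zero)
      moreover have "0 \<le> d (s n) x" by (rule nonneg)
      ultimately show "\<bar>(d (s n) z - d (s n) x) - (d x z - d x x)\<bar> < e" by argo
    qed
  qed
qed

text \<open>
  Let \<open>r\<close> be the distance from \<open>x\<close> to the frontier of \<open>C\<close>. If \<open>s n\<close> is outside \<open>C\<close>, then crossing the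
  frontier at \<open>z\<close> costs \<open>d x z\<close>, so \<open>d (s n) z - d (s n) x\<close> is less than \<open>r / 2 - d x z\<close>, hence
  negative; but for large \<open>n\<close> it differs from \<open>d x z \<ge> r\<close> by less than \<open>r / 2\<close>.
\<close>

lemma embed_converges_eventually_in:
  assumes s: "\<And>n. s n \<in> \<Omega>" and x: "x \<in> \<Omega>"
    and lim: "limitin (metric_compactification \<Omega> d) (\<lambda>n::nat. embed (s n)) (embed x) sequentially"
    and C: "compact C" "C \<subseteq> \<Omega>" "x \<in> interior C"
  shows "eventually (\<lambda>n. s n \<in> C) sequentially"
proof -
  have clC: "closed C" using C(1) by (rule compact_imp_closed)
  have fr: "frontier C \<subseteq> C" "x \<notin> frontier C"
    using clC C(3) by (auto simp: frontier_def)
  have "compact (C \<inter> frontier C)" using C(1) by (intro compact_Int_closed) auto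
  then have cfr: "compact (frontier C)" using fr(1) by (simp add: inf.absorb2)
  have "\<exists>r>0. \<forall>z\<in>frontier C. r \<le> d x z"
  proof (cases "frontier C = {}")
    case False
    have "continuous_on (frontier C) (d x)"
      using continuous_on_dist[OF x] by (rule continuous_on_subset) (use fr C in blast)
    then obtain z0 where z0: "z0 \<in> frontier C" "\<forall>z\<in>frontier C. d x z0 \<le> d x z"
      using continuous_attains_inf[OF cfr False] by blast
    have "z0 \<in> \<Omega>" "z0 \<noteq> x" using z0(1) fr C(2) by blast+
    then have "d x z0 > 0" using x nonneg[of x z0] zero[of x z0] by auto
    then show ?thesis using z0(2) by blast
  qed (auto intro: exI[of _ 1])
  then obtain r where r: "r > 0" "\<And>z. z \<in> frontier C \<Longrightarrow> r \<le> d x z" by blast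
  have "frontier C \<subseteq> \<Omega>" "r / 2 > 0" using fr C(2) r(1) by auto
  then have "eventually (\<lambda>n. \<forall>z\<in>frontier C. \<bar>(d (s n) z - d (s n) x) - (d x z - d x x)\<bar> < r / 2) sequentially"
    using lim cfr unfolding limitin_embed_iff[OF x s x] by blast
  then show ?thesis
  proof (rule eventually_mono)
    fix n assume n: "\<forall>z\<in>frontier C. \<bar>(d (s n) z - d (s n) x) - (d x z - d x x)\<bar> < r / 2"
    show "s n \<in> C"
    proof (rule ccontr)
      assume "s n \<notin> C"
      then obtain z where z: "z \<in> frontier C" "z \<in> \<Omega>" "d x z + d z (s n) < d x (s n) + r / 2"
        using crosses_frontier[OF x s, of C n "r / 2"] r(1) C(3) interior_subset by auto
      have "\<bar>(d (s n) z - d (s n) x) - (d x z - d x x)\<bar> < r / 2" using n z(1) by blast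
      moreover have "d x x = 0" using x by (simp add: zero)
      ultimately show False
        using z(3) r(2)[OF z(1)] commute[of z "s n"] commute[of x "s n"] by argo
    qed
  qed
qed

lemma embed_converges_imp_tendsto:
  assumes s: "\<And>n. s n \<in> \<Omega>" and x: "x \<in> \<Omega>"
    and lim: "limitin (metric_compactification \<Omega> d) (\<lambda>n::nat. embed (s n)) (embed x) sequentially"
  shows "s \<longlonglongrightarrow> x"
proof (rule topological_tendstoI)
  fix U assume U: "open U" "x \<in> U"
  have "open (U \<inter> \<Omega>)" "x \<in> U \<inter> \<Omega>" using U x open_domain by auto
  then obtain V C where C: "open V" "compact C" "x \<in> V" "V \<subseteq> C" "C \<subseteq> U \<inter> \<Omega>"
    using locally_compact[of "U \<inter> \<Omega>" x] by auto
  then have "x \<in> interior C" by (blast intro: interiorI)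
  then have "eventually (\<lambda>n. s n \<in> C) sequentially"
    using C by (intro embed_converges_eventually_in[OF s x lim]) auto
  then show "eventually (\<lambda>n. s n \<in> U) sequentially"
    by (rule eventually_mono) (use C(5) in blast)
qed

text \<open>
  The theorem of Arzela and Ascoli for the functions \<open>d (s n) - d (s n) p\<close>, which are 1-Lipschitz with
  respect to \<open>d\<close> and bounded by \<open>d p\<close>: a diagonal subsequence converges on a countable dense set, and
  equicontinuity extends the convergence to \<open>\<Omega>\<close>, uniformly on compact sets.
\<close>

lemma embed_subsequence_converges:
  assumes p: "p \<in> \<Omega>" and s: "\<And>n. s n \<in> \<Omega>"
  obtains r \<xi> where "strict_mono (r :: nat \<Rightarrow> nat)"
    "limitin (metric_compactification \<Omega> d) (\<lambda>n. embed (s (r n))) \<xi> sequentially"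
proof -
  define h where "h = (\<lambda>n z. d (s n) z - d (s n) p)"
  have bound: "\<bar>h n z\<bar> \<le> d p z" if "z \<in> \<Omega>" for n z
    unfolding h_def using dist_diff_le'[OF s that p] commute[of p z] by simp
  have lip: "\<bar>h n z - h n w\<bar> \<le> d z w" if "z \<in> \<Omega>" "w \<in> \<Omega>" for n z w
    unfolding h_def using dist_diff_le'[OF s that] by simp
  obtain D :: "'a set" where D: "countable D" "\<And>X. open X \<Longrightarrow> X \<noteq> {} \<Longrightarrow> \<exists>d\<in>D. d \<in> X"
    using countable_dense_setE by blast
  \<comment> \<open>Division by \<open>1 + d p z\<close> turns the pointwise bounds into a uniform one.\<close>
  have "countable (D \<inter> \<Omega>)" using D(1) by simp
  moreover have "norm (h n z / (1 + d p z)) \<le> 1" if "z \<in> D \<inter> \<Omega>" for n z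
  proof -
    have "0 < 1 + d p z" using nonneg[of p z] by linarith
    then show ?thesis using bound[of z n] that by (simp add: abs_divide)
  qed
  ultimately obtain r where r: "strict_mono (r :: nat \<Rightarrow> nat)"
    "\<And>z. z \<in> D \<inter> \<Omega> \<Longrightarrow> \<exists>l. (\<lambda>n. h (r n) z / (1 + d p z)) \<longlonglongrightarrow> l"
    using function_convergent_subsequence[of "D \<inter> \<Omega>" "\<lambda>n z. h n z / (1 + d p z)" 1] by blast
  have cauchyD: "Cauchy (\<lambda>n. h (r n) z)" if z: "z \<in> D \<inter> \<Omega>" for z
  proof -
    obtain l where "(\<lambda>n. h (r n) z / (1 + d p z)) \<longlonglongrightarrow> l" using r(2)[OF z] by blast
    then have "(\<lambda>n. h (r n) z / (1 + d p z) * (1 + d p z)) \<longlonglongrightarrow> l * (1 + d p z)"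
      by (intro tendsto_intros)
    moreover have "1 + d p z \<noteq> 0" using nonneg[of p z] by linarith
    ultimately have "(\<lambda>n. h (r n) z) \<longlonglongrightarrow> l * (1 + d p z)" by simp
    then show ?thesis by (rule LIMSEQ_imp_Cauchy)
  qed
  have "convergent (\<lambda>n. h (r n) z)" if z: "z \<in> \<Omega>" for z
  proof -
    have "Cauchy (\<lambda>n. h (r n) z)"
    proof (rule metric_CauchyI)
      fix e :: real assume "e > 0"
      then have e: "e / 3 > 0" by simp
      obtain V where V: "open V" "z \<in> V" "V \<subseteq> \<Omega>" "\<forall>y\<in>V. d z y < e / 3"
        using small_near[OF z e] by blast
      then obtain y where y: "y \<in> D" "y \<in> V" using D(2) by blast
      then obtain N where N: "\<And>m n. m \<ge> N \<Longrightarrow> n \<ge> N \<Longrightarrow> dist (h (r m) y) (h (r n) y) < e / 3"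
        using metric_CauchyD[OF cauchyD[of y] e] V(3) by blast
      have yz: "\<bar>h (r k) z - h (r k) y\<bar> < e / 3" for k
        using lip[OF z, of y "r k"] V(3,4) y(2) by force
      have "dist (h (r m) z) (h (r n) z) < e" if "m \<ge> N" "n \<ge> N" for m n
        using N[OF that] yz[of m] yz[of n] unfolding dist_real_def by argo
      then show "\<exists>N. \<forall>m\<ge>N. \<forall>n\<ge>N. dist (h (r m) z) (h (r n) z) < e" by blast
    qed
    then show ?thesis by (rule Cauchy_convergent)
  qed
  then obtain g0 where g0: "\<And>z. z \<in> \<Omega> \<Longrightarrow> (\<lambda>n. h (r n) z) \<longlonglongrightarrow> g0 z"
    unfolding convergent_def by metis
  define g where "g = restrict g0 \<Omega>"
  have g: "(\<lambda>n. h (r n) z) \<longlonglongrightarrow> g z" if "z \<in> \<Omega>" for z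
    using g0[OF that] that by (simp add: g_def)
  have glip: "\<bar>g z - g w\<bar> \<le> d z w" if "z \<in> \<Omega>" "w \<in> \<Omega>" for z w
  proof (rule LIMSEQ_le_const2)
    show "(\<lambda>n. \<bar>h (r n) z - h (r n) w\<bar>) \<longlonglongrightarrow> \<bar>g z - g w\<bar>"
      using g that by (intro tendsto_intros) auto
  qed (use lip that in auto)
  have gc: "g \<in> cont_funs \<Omega>"
    using continuous_on_if_Lipschitz[of g] glip by (simp add: cont_funs_def g_def)
  have "g p = 0"
    using LIMSEQ_unique[OF g[OF p], of 0] by (simp add: h_def)
  have "eventually (\<lambda>n. \<forall>z\<in>C. \<bar>(d (s (r n)) z - d (s (r n)) p) - (g z - g p)\<bar> < e) sequentially"
    if C: "compact C" "C \<subseteq> \<Omega>" "e > 0" for C e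
  proof -
    have e: "e / 3 > 0" using C(3) by simp
    have "\<forall>z\<in>C. \<exists>V. open V \<and> z \<in> V \<and> V \<subseteq> \<Omega> \<and> (\<forall>y\<in>V. d z y < e / 3)"
      using small_near[OF _ e] C(2) by blast
    then obtain V where V: "\<And>z. z \<in> C \<Longrightarrow> open (V z)" "\<And>z. z \<in> C \<Longrightarrow> z \<in> V z"
      "\<And>z. z \<in> C \<Longrightarrow> V z \<subseteq> \<Omega>" "\<And>z y. z \<in> C \<Longrightarrow> y \<in> V z \<Longrightarrow> d z y < e / 3" by metis
    obtain I where I: "I \<subseteq> C" "finite I" "C \<subseteq> (\<Union>z\<in>I. V z)"
      using compactE_image[OF C(1), of C V] V(1,2) by blast
    have "eventually (\<lambda>n. \<bar>h (r n) z - g z\<bar> < e / 3) sequentially" if "z \<in> I" for z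
      using tendstoD[OF g e, of z] that I(1) C(2) by (auto simp: dist_real_def)
    then have "eventually (\<lambda>n. \<forall>z\<in>I. \<bar>h (r n) z - g z\<bar> < e / 3) sequentially"
      using I(2) by (simp add: eventually_ball_finite)
    then show ?thesis
    proof (rule eventually_mono, intro ballI)
      fix n z assume n: "\<forall>z\<in>I. \<bar>h (r n) z - g z\<bar> < e / 3" and z: "z \<in> C"
      obtain w where w: "w \<in> I" "z \<in> V w" using I(3) z by blast
      have "w \<in> \<Omega>" "z \<in> \<Omega>" "d w z < e / 3" using w I(1) C(2) z V(4) by blast+
      then have "\<bar>h (r n) w - h (r n) z\<bar> < e / 3" "\<bar>g w - g z\<bar> < e / 3"
        using lip[of w z "r n"] glip[of w z] by linarith+
      moreover have "\<bar>h (r n) w - g w\<bar> < e / 3" using n w(1) by blast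
      ultimately have "\<bar>h (r n) z - g z\<bar> < e" by argo
      then show "\<bar>(d (s (r n)) z - d (s (r n)) p) - (g z - g p)\<bar> < e"
        using \<open>g p = 0\<close> by (simp add: h_def)
    qed
  qed
  then have "limitin (metric_compactification \<Omega> d) (\<lambda>n. embed (s (r n))) (mod_const_rel \<Omega> `` {g}) sequentially"
    using limitin_class_iff[OF p, of "s \<circ> r" g] s gc by simp
  then show ?thesis using that r(1) by blast
qed

end

section \<open>Comparison of the two compactifications\<close>

locale compactified_domain = crossing_metric_domain \<Omega> d + seq_compact_ends "closure \<Omega>" K
  for \<Omega> :: "'a::{t2_space, second_countable_topology} set" and d :: "'a \<Rightarrow> 'a \<Rightarrow> real"
    and K :: "nat \<Rightarrow> 'a set" +
  assumes nonempty: "\<Omega> \<noteq> {}"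
begin

abbreviation metric_comp :: "('a \<Rightarrow> real) set topology" where
  "metric_comp \<equiv> metric_compactification \<Omega> d"

abbreviation end_comp :: "('a + (nat \<Rightarrow> 'a set)) topology" where
  "end_comp \<equiv> end_compactification (closure \<Omega>) K"

lemma limitin_Inl_domain_iff:
  "x \<in> closure \<Omega> \<Longrightarrow> range s \<subseteq> \<Omega> \<Longrightarrow> limitin end_comp (\<lambda>n. Inl (s n)) (Inl x) F \<longleftrightarrow> (s \<longlongrightarrow> x) F"
  using closure_subset[of \<Omega>] by (intro limitin_Inl_iff) auto

lemma end_limit_unique:
  "limitin end_comp f l sequentially \<Longrightarrow> limitin end_comp f l' sequentially \<Longrightarrow> l = l'"
  using Hausdorff_end_compactification by (meson limitin_Hausdorff_unique trivial_limit_sequentially)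

lemma metric_limit_unique:
  "limitin metric_comp f l sequentially \<Longrightarrow> limitin metric_comp f l' sequentially \<Longrightarrow> l = l'"
  using Hausdorff_metric_compactification nonempty
  by (meson ex_in_conv limitin_Hausdorff_unique trivial_limit_sequentially)

text \<open>
  This is where the crossing of frontiers enters: without it \<open>s\<close> might escape from \<open>\<Omega>\<close>.
\<close>

lemma end_limit_over_interior_point:
  assumes s: "range s \<subseteq> \<Omega>" and x: "x \<in> \<Omega>"
    and m: "limitin metric_comp (\<lambda>n. embed (s n)) (embed x) sequentially"
    and l: "limitin end_comp (\<lambda>n. Inl (s n)) l sequentially"
  shows "l = Inl x"
proof -
  have "s \<longlonglongrightarrow> x" using s by (intro embed_converges_imp_tendsto[OF _ x m]) auto
  then have "limitin end_comp (\<lambda>n. Inl (s n)) (Inl x) sequentially"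
    using limitin_Inl_domain_iff[OF _ s] x closure_subset[of \<Omega>] by blast
  then show ?thesis using end_limit_unique l by blast
qed

text \<open>
  A boundary point of the metric compactification is not the limit of a sequence that converges in \<open>\<Omega>\<close>,
  because the embedding is continuous and limits are unique.
\<close>

lemma in_metric_fibre:
  assumes s: "range s \<subseteq> \<Omega>" and \<xi>: "\<xi> \<notin> embed ` \<Omega>"
    and m: "limitin metric_comp (\<lambda>n. embed (s n)) \<xi> sequentially"
    and l: "limitin end_comp (\<lambda>n. Inl (s n)) l sequentially"
  shows "l \<in> end_boundary \<Omega> K" "\<xi> \<in> metric_fibre \<Omega> K d l"
proof -
  have "l \<notin> Inl ` \<Omega>"
  proof
    assume "l \<in> Inl ` \<Omega>"
    then obtain y where y: "y \<in> \<Omega>" "l = Inl y" by blast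
    then have "s \<longlonglongrightarrow> y" using limitin_Inl_domain_iff[OF _ s, of y] l closure_subset[of \<Omega>] by blast
    then have "limitin metric_comp (\<lambda>n. embed (s n)) (embed y) sequentially"
      using s by (intro embed_continuous y(1)) auto
    then have "\<xi> = embed y" using metric_limit_unique m by blast
    then show False using \<xi> y(1) by blast
  qed
  moreover have "l \<in> topspace end_comp" using l by (simp add: limitin_def)
  ultimately show "l \<in> end_boundary \<Omega> K" by (simp add: end_boundary_def)
  have "\<xi> \<in> topspace metric_comp" using m by (simp add: limitin_def)
  then show "\<xi> \<in> metric_fibre \<Omega> K d l" unfolding metric_fibre_def using s \<xi> m l by blast
qed

text \<open>
  Over an interior point both limits are that point, because the embedding is a homeomorphism onto its
  image; over a boundary point they agree because the fibres are disjoint.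
\<close>

lemma end_limit_determined:
  assumes disjoint: "\<forall>x\<in>end_boundary \<Omega> K. \<forall>y\<in>end_boundary \<Omega> K. x \<noteq> y \<longrightarrow>
      metric_fibre \<Omega> K d x \<inter> metric_fibre \<Omega> K d y = {}"
    and st: "range s \<subseteq> \<Omega>" "range t \<subseteq> \<Omega>"
    and s: "limitin metric_comp (\<lambda>n. embed (s n)) \<xi> sequentially"
      "limitin end_comp (\<lambda>n. Inl (s n)) l sequentially"
    and t: "limitin metric_comp (\<lambda>n. embed (t n)) \<xi> sequentially"
      "limitin end_comp (\<lambda>n. Inl (t n)) l' sequentially"
  shows "l = l'"
proof (cases "\<xi> \<in> embed ` \<Omega>")
  case True
  then obtain x where "x \<in> \<Omega>" "\<xi> = embed x" by blast
  then show ?thesis using end_limit_over_interior_point[of s x l] end_limit_over_interior_point[of t x l'] st s t by simp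
next
  case False
  then show ?thesis
    using disjoint in_metric_fibre[OF st(1) False s] in_metric_fibre[OF st(2) False t] by blast
qed

lemma sequence_to_end_point:
  assumes y: "y \<in> topspace end_comp"
  obtains s where "range s \<subseteq> \<Omega>" "limitin end_comp (\<lambda>n. Inl (s n)) y sequentially"
proof -
  consider x where "x \<in> closure \<Omega>" "y = Inl x" | F where "F \<in> ends (closure \<Omega>) K" "y = Inr F"
    using y unfolding topspace_end_compactification by blast
  then show ?thesis
  proof cases
    case 1
    then obtain s where s: "\<forall>n. s n \<in> \<Omega>" "s \<longlonglongrightarrow> x" using closure_sequential[of x \<Omega>] by blast
    then have "range s \<subseteq> \<Omega>" by blast
    then show ?thesis using that[of s] s(2) 1 limitin_Inl_domain_iff[OF 1(1), of s] by simp
  next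
    case 2
    obtain s where "range s \<subseteq> \<Omega>" "limitin end_comp (\<lambda>n. Inl (s n)) (Inr F) sequentially"
      by (rule end_limit_of_dense_sequence[OF refl 2(1)])
    then show ?thesis using that 2(2) by blast
  qed
qed

lemma fibres_disjoint_of_extension:
  assumes F: "continuous_map metric_comp end_comp F" "\<forall>x\<in>\<Omega>. F (embed x) = Inl x"
    and \<xi>: "\<xi> \<in> metric_fibre \<Omega> K d x" "\<xi> \<in> metric_fibre \<Omega> K d y"
  shows "x = y"
proof -
  have "F \<xi> = z" if z: "\<xi> \<in> metric_fibre \<Omega> K d z" for z
  proof -
    obtain s :: "nat \<Rightarrow> 'a" where s: "range s \<subseteq> \<Omega>" "limitin end_comp (\<lambda>n. Inl (s n)) z sequentially"
      "limitin metric_comp (\<lambda>n. embed (s n)) \<xi> sequentially"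
      using z unfolding metric_fibre_def by blast
    have "limitin end_comp (F \<circ> (\<lambda>n. embed (s n))) (F \<xi>) sequentially"
      using F(1) s(3) by (rule continuous_map_limit)
    moreover have "F \<circ> (\<lambda>n. embed (s n)) = (\<lambda>n. Inl (s n))"
      using F(2) s(1) by (auto simp: fun_eq_iff)
    ultimately show ?thesis using end_limit_unique s(2) by simp
  qed
  then show ?thesis using \<xi> by blast
qed

lemma extension_of_fibres_disjoint:
  assumes disjoint: "\<forall>x\<in>end_boundary \<Omega> K. \<forall>y\<in>end_boundary \<Omega> K. x \<noteq> y \<longrightarrow>
      metric_fibre \<Omega> K d x \<inter> metric_fibre \<Omega> K d y = {}"
  shows "\<exists>F. continuous_map metric_comp end_comp F \<and> F ` topspace metric_comp = topspace end_comp \<and>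
    (\<forall>x\<in>\<Omega>. F (embed x) = Inl x)"
proof -
  obtain p where p: "p \<in> \<Omega>" using nonempty by blast
  have "Inl ` \<Omega> \<subseteq> topspace end_comp"
    unfolding topspace_end_compactification using closure_subset[of \<Omega>] by blast
  then obtain F where F: "continuous_map metric_comp end_comp F"
    "\<forall>s \<xi> l. range s \<subseteq> \<Omega> \<and> limitin metric_comp (\<lambda>n. embed (s n)) \<xi> sequentially \<and>
       limitin end_comp (\<lambda>n. Inl (s n)) l sequentially \<longrightarrow> F \<xi> = l"
    by (rule continuous_extension_of_dense[OF first_countable_metric_compactification[OF p]
        Hausdorff_end_compactification seq_compact embed_dense _ end_limit_determined[OF disjoint]])
  have "F (embed x) = Inl x" if x: "x \<in> \<Omega>" for x
  proof -
    have "limitin metric_comp (\<lambda>n::nat. embed x) (embed x) sequentially"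
      using x by (intro embed_continuous tendsto_const)
    moreover have "limitin end_comp (\<lambda>n::nat. Inl x) (Inl x) sequentially"
      using x limitin_Inl_domain_iff[of x "\<lambda>_. x"] closure_subset[of \<Omega>] by auto
    ultimately show ?thesis using F(2)[rule_format, of "\<lambda>_. x"] x by blast
  qed
  moreover have "F ` topspace metric_comp = topspace end_comp"
  proof
    show "F ` topspace metric_comp \<subseteq> topspace end_comp"
      using continuous_map_image_subset_topspace[OF F(1)] .
    show "topspace end_comp \<subseteq> F ` topspace metric_comp"
    proof
      fix y assume "y \<in> topspace end_comp"
      then obtain s where s: "range s \<subseteq> \<Omega>" "limitin end_comp (\<lambda>n. Inl (s n)) y sequentially"
        by (rule sequence_to_end_point)
      have "s n \<in> \<Omega>" for n using s(1) by blast
      then obtain r \<xi> where r: "strict_mono (r :: nat \<Rightarrow> nat)"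
        "limitin metric_comp (\<lambda>n. embed (s (r n))) \<xi> sequentially"
        by (rule embed_subsequence_converges[OF p])
      have "limitin end_comp (\<lambda>n. Inl (s (r n))) y sequentially"
        using limitin_subsequence[OF r(1) s(2)] by (simp add: o_def)
      moreover have "range (\<lambda>n. s (r n)) \<subseteq> \<Omega>" using s(1) by blast
      ultimately have "F \<xi> = y" using F(2) r(2) by blast
      moreover have "\<xi> \<in> topspace metric_comp" using r(2) by (simp add: limitin_def)
      ultimately show "y \<in> F ` topspace metric_comp" by blast
    qed
  qed
  ultimately show ?thesis using F(1) by blast
qed

end

theorem theorem1p8:
  fixes A :: "('a::{t2_space, second_countable_topology} set \<times> ('a \<Rightarrow> complex ^ 'n)) set"
    and \<Omega> :: "'a set" and K :: "nat \<Rightarrow> 'a set"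
  assumes "complex_atlas A"
    and "open \<Omega>" and "connected \<Omega>" and "\<Omega> \<noteq> {}" and "\<Omega> \<noteq> UNIV"
    and "kobayashi_hyperbolic A \<Omega>"
    and "compact_exhaustion (closure \<Omega>) K"
    and "seq_compact_space (end_compactification (closure \<Omega>) K)"
  shows
    "(\<exists>F. continuous_map (metric_compactification \<Omega> (kobayashi A \<Omega>))
            (end_compactification (closure \<Omega>) K) F \<and>
          F ` topspace (metric_compactification \<Omega> (kobayashi A \<Omega>)) =
            topspace (end_compactification (closure \<Omega>) K) \<and>
          (\<forall>x\<in>\<Omega>. F (metric_embed \<Omega> (kobayashi A \<Omega>) x) = Inl x))
     \<longleftrightarrow>
     (\<forall>x\<in>end_boundary \<Omega> K. \<forall>y\<in>end_boundary \<Omega> K. x \<noteq> y \<longrightarrow>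
        metric_fibre \<Omega> K (kobayashi A \<Omega>) x \<inter> metric_fibre \<Omega> K (kobayashi A \<Omega>) y = {})"
proof -
  have M: "Metric_space \<Omega> (kobayashi A \<Omega>)"
    using assms(6) by (simp add: kobayashi_hyperbolic_def)
  interpret compactified_domain \<Omega> "kobayashi A \<Omega>" K
  proof (intro compactified_domain.intro crossing_metric_domain.intro M
      crossing_metric_domain_axioms.intro seq_compact_ends.intro exhausted.intro
      seq_compact_ends_axioms.intro compactified_domain_axioms.intro)
    show "\<exists>V. open V \<and> x \<in> V \<and> V \<subseteq> \<Omega> \<and> (\<forall>y\<in>V. kobayashi A \<Omega> x y < e)"
      if "x \<in> \<Omega>" "e > 0" for x e
      using kobayashi_small_near[OF assms(1,2) that] .
    show "\<exists>V C. open V \<and> compact C \<and> x \<in> V \<and> V \<subseteq> C \<and> C \<subseteq> U" if "open U" "x \<in> U"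
      for x :: 'a and U
      using atlas_compact_neighbourhood[OF assms(1) that] .
    show "\<exists>z\<in>frontier C. z \<in> \<Omega> \<and> kobayashi A \<Omega> x z + kobayashi A \<Omega> z y < kobayashi A \<Omega> x y + e"
      if "x \<in> \<Omega>" "y \<in> \<Omega>" "x \<in> C" "y \<notin> C" "e > 0" for x y C e
      using kobayashi_crosses_frontier[OF assms(1,2,3) M that] .
  qed (use assms in auto)
  show ?thesis
  proof (rule iffI)
    assume "\<exists>F. continuous_map metric_comp end_comp F \<and> F ` topspace metric_comp = topspace end_comp \<and>
      (\<forall>x\<in>\<Omega>. F (embed x) = Inl x)"
    then obtain F where "continuous_map metric_comp end_comp F" "\<forall>x\<in>\<Omega>. F (embed x) = Inl x"
      by (elim exE conjE)
    then show "\<forall>x\<in>end_boundary \<Omega> K. \<forall>y\<in>end_boundary \<Omega> K. x \<noteq> y \<longrightarrow>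
        metric_fibre \<Omega> K (kobayashi A \<Omega>) x \<inter> metric_fibre \<Omega> K (kobayashi A \<Omega>) y = {}"
      using fibres_disjoint_of_extension by (metis disjoint_iff)
  qed (rule extension_of_fibres_disjoint)
qed

end
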